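(* Let $q=2^{2e+1}$ with $e\ge1$, and let $U$ be a Buekenhout-Tits unital in $\mathrm{PG}(2,q^2)$, with homogeneous coordinates chosen so that $U=\mathcal{U}_{BT}$. Then the stabiliser group of $U$ in $\mathrm{P\Gamma L}(3,q^2)$ is the group $GK$ of order $q^2(4e+2)$, where $K$ is a cyclic subgroup of order $16e+8$ generated by $$\psi:\ \mathbf{x}\mapsto \mathbf{x}^{2}\begin{bmatrix}1 & 1 & \epsilon\\ 0 & \delta^{\sigma/2}(1+\epsilon) & \delta^{\sigma/2}(1+\epsilon)\\ 0&0&\delta^{\sigma+1}\end{bmatrix}.$$ Here $\mathbf{x}$ denotes the row vector of homogeneous coordinates of a point, and $\mathbf{x}^2$ denotes its elementwise square.
   Context: Let $\sigma=2^{e+1}$. Fix $\epsilon\in\mathbb{F}_{q^2}$ with $\epsilon^q=\epsilon+1$ and $\epsilon^2=\epsilon+\delta$, where $1\neq\delta\in\mathbb{F}_q$ has absolute trace $1$. The following set is a Buekenhout-Tits unital in $\mathrm{PG}(2,q^2)$: $$\mathcal{U}_{BT}=\{(0,0,1)\}\cup\{(1,\ s+t\epsilon,\ r+(s^{\sigma+2}+t^\sigma+st)\epsilon) : r,s,t\in\mathbb{F}_q\}.$$ The group $G=\mathrm{PGL}(3,q^2)_{\mathcal{U}_{BT}}$ of projectivities stabilising $\mathcal{U}_{BT}$ consists of the projectivities induced by the matrices $$M_{u,v}=\begin{bmatrix}1&u\epsilon&v+u^\sigma\epsilon\\0&1&u+u\epsilon\\0&0&1\end{bmatrix},\qquad u,v\in\mathbb{F}_q,$$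 acting on row vectors of homogeneous coordinates by multiplication from the right; it is abelian of order $q^2$. Buekenhout-Tits unitals in general are defined by the André/Bruck-Bose (ABB) construction: fix a hyperplane $\Sigma$ of $\mathrm{PG}(4,q)$ with a Desarguesian line spread $\mathcal{S}$; points of $\mathrm{PG}(2,q^2)$ are the points of $\mathrm{PG}(4,q)\setminus\Sigma$ and the lines of $\mathcal{S}$ (the points of $\ell_\infty$), lines are $\ell_\infty$ and the planes not in $\Sigma$ meeting $\Sigma$ in a line of $\mathcal{S}$. A Tits ovoid of $\mathrm{PG}(3,q)$ is a point set projectively equivalent to $\{(0,0,0,1)\}\cup\{(1,s,t,s^{\sigma+2}+t^\sigma+st):s,t\in\mathbb{F}_q\}$. A Buekenhout-Tits unital is a unital (a set of $q^3+1$ points met by every line in $1$ or $q+1$ points) arising from an ovoidal cone $\mathcal{C}$ (union of the lines joining a point $V$ to the points of an ovoid in a hyperplane not through $V$) whose base is a Tits ovoid and for which $\mathcal{C}\cap\Sigma$ is a line of $\mathcal{S}$; its points are those of $\mathcal{C}\setminus\Sigma$ and the point of $\ell_\infty$ corresponding to $\mathcal{C}\cap\Sigma$. All Buekenhout-Tits unitals in $\mathrm{PG}(2,q^2)$ are $\mathrm{PGL}$-equivalent, so coordinates with $U=\mathcal{U}_{BT}$ can always be chosen. *)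

theory Defs
  imports "HOL-Analysis.Analysis" "HOL-Algebra.Elementary_Groups" "HOL-Algebra.Bij"
begin

section \<open>The projective plane over a field and its collineations\<close>

text \<open>A point of the plane is a one-dimensional subspace of the space of row vectors.\<close>

definition proj_point :: "'a::field ^ 3 \<Rightarrow> ('a ^ 3) set" where
  "proj_point x = vec.span {x}"

definition proj_points :: "('a::field ^ 3) set set" where
  "proj_points = {proj_point x | x. x \<noteq> 0}"

definition proj_line :: "'a::field ^ 3 \<Rightarrow> ('a ^ 3) set set" where
  "proj_line a = {proj_point x | x. x \<noteq> 0 \<and> (\<Sum>i\<in>UNIV. a $ i * x $ i) = 0}"

definition proj_lines :: "('a::field ^ 3) set set set" where
  "proj_lines = {proj_line a | a. a \<noteq> 0}"

definition field_automorphism :: "('a::field \<Rightarrow> 'a) \<Rightarrow> bool" where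
  "field_automorphism \<tau> \<longleftrightarrow>
     bij \<tau> \<and> (\<forall>x y. \<tau> (x + y) = \<tau> x + \<tau> y) \<and> (\<forall>x y. \<tau> (x * y) = \<tau> x * \<tau> y)"

definition semilinear_map :: "('a::field \<Rightarrow> 'a) \<Rightarrow> 'a ^ 3 ^ 3 \<Rightarrow> 'a ^ 3 \<Rightarrow> 'a ^ 3" where
  "semilinear_map \<tau> A x = (\<chi> i. \<tau> (x $ i)) v* A"

text \<open>The map on points induced by a semilinear map. It is restricted to the points (undefined
  elsewhere), as the carrier of \<^const>\<open>BijGroup\<close> consists of extensional functions.\<close>

definition collineation ::
    "('a::field \<Rightarrow> 'a) \<Rightarrow> 'a ^ 3 ^ 3 \<Rightarrow> ('a ^ 3) set \<Rightarrow> ('a ^ 3) set" where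
  "collineation \<tau> A = (\<lambda>P \<in> proj_points. semilinear_map \<tau> A ` P)"

definition PGammaL :: "(('a::field ^ 3) set \<Rightarrow> ('a ^ 3) set) monoid" where
  "PGammaL = (BijGroup proj_points)
     \<lparr>carrier := {collineation \<tau> A | \<tau> A. field_automorphism \<tau> \<and> invertible A}\<rparr>"

definition PGL :: "(('a::field ^ 3) set \<Rightarrow> ('a ^ 3) set) monoid" where
  "PGL = (BijGroup proj_points) \<lparr>carrier := {collineation id A | A. invertible A}\<rparr>"

definition set_stabiliser :: "('p \<Rightarrow> 'p) monoid \<Rightarrow> 'p set \<Rightarrow> ('p \<Rightarrow> 'p) set" where
  "set_stabiliser G U = {g \<in> carrier G. g ` U = U}"

definition unital :: "nat \<Rightarrow> ('a::field ^ 3) set set \<Rightarrow> bool" where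
  "unital q U \<longleftrightarrow> U \<subseteq> proj_points \<and> card U = q ^ 3 + 1 \<and>
     (\<forall>l \<in> proj_lines. card (l \<inter> U) = 1 \<or> card (l \<inter> U) = q + 1)"


section \<open>The Andre/Bruck-Bose model and Buekenhout-Tits unitals\<close>

text \<open>The field with \<open>q\<close> elements, as a subfield of the field with \<open>q\<^sup>2\<close> elements.\<close>

definition Fq :: "nat \<Rightarrow> 'a::field set" where
  "Fq q = {x. x ^ q = x}"

definition fq_subspace :: "nat \<Rightarrow> ('a::field ^ 3) set \<Rightarrow> bool" where
  "fq_subspace q W \<longleftrightarrow>
     0 \<in> W \<and> (\<forall>x\<in>W. \<forall>y\<in>W. x + y \<in> W) \<and> (\<forall>c\<in>Fq q. \<forall>x\<in>W. c *s x \<in> W)"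

definition fq_span :: "nat \<Rightarrow> ('a::field ^ 3) set \<Rightarrow> ('a ^ 3) set" where
  "fq_span q S = fq_subspace q hull S"

definition fq_independent :: "nat \<Rightarrow> nat \<Rightarrow> (nat \<Rightarrow> 'a::field ^ 3) \<Rightarrow> bool" where
  "fq_independent q n b \<longleftrightarrow>
     (\<forall>c. (\<forall>i<n. c i \<in> Fq q) \<and> (\<Sum>i<n. c i *s b i) = 0 \<longrightarrow> (\<forall>i<n. c i = 0))"

text \<open>
  The ambient space \<open>PG(4,q)\<close> is that of the five-dimensional vector space over \<open>Fq q\<close> formed by
  the triples whose first coordinate lies in \<open>Fq q\<close>. The hyperplane \<open>\<Sigma>\<close> at infinity is given by
  the vanishing of the first coordinate, and its Desarguesian spread consists of the
  one-dimensional subspaces over the large field contained in it, so that a spread line is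
  literally a point of the plane at infinity. An affine point \<open>fq_span q {x}\<close> with \<open>x $ 1 \<noteq> 0\<close> is
  the point \<open>proj_point x\<close> of the plane.
\<close>

definition abb_vectors :: "nat \<Rightarrow> ('a::field ^ 3) set" where
  "abb_vectors q = {x. x $ 1 \<in> Fq q}"

definition tits_fun :: "nat \<Rightarrow> 'a::field \<Rightarrow> 'a \<Rightarrow> 'a" where
  "tits_fun e s t = s ^ (2 ^ (e + 1) + 2) + t ^ (2 ^ (e + 1)) + s * t"

text \<open>\<open>T\<close> is a Tits ovoid of the solid with underlying vector space \<open>H\<close>: in the coordinates given
  by some basis of \<open>H\<close> it is the standard one.\<close>

definition tits_ovoid :: "nat \<Rightarrow> ('a::field ^ 3) set \<Rightarrow> ('a ^ 3) set set \<Rightarrow> bool" where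
  "tits_ovoid e H T \<longleftrightarrow> (let q = 2 ^ (2 * e + 1) in
     \<exists>b. fq_independent q 4 b \<and> H = fq_span q (b ` {..<4}) \<and>
       T = {fq_span q {b 3}} \<union>
           {fq_span q {b 0 + s *s b 1 + t *s b 2 + tits_fun e s t *s b 3} | s t.
              s \<in> Fq q \<and> t \<in> Fq q})"

text \<open>The set of vectors lying on a cone with vertex \<open>fq_span q {v}\<close> and base \<open>T\<close>.\<close>

definition cone_vectors ::
    "nat \<Rightarrow> 'a::field ^ 3 \<Rightarrow> ('a ^ 3) set set \<Rightarrow> ('a ^ 3) set" where
  "cone_vectors q v T = (\<Union>P\<in>T. fq_span q (insert v P))"

text \<open>The projectivity \<open>g\<close> allows for an arbitrary choice of the line at infinity and of
  coordinates for the plane.\<close>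

definition buekenhout_tits_unital :: "nat \<Rightarrow> ('a::field ^ 3) set set \<Rightarrow> bool" where
  "buekenhout_tits_unital e U \<longleftrightarrow> (let q = 2 ^ (2 * e + 1) in
     unital q U \<and>
     (\<exists>g \<in> carrier PGL. \<exists>v H T. \<exists>C.
        v \<in> abb_vectors q \<and> H \<subseteq> abb_vectors q \<and> v \<notin> H \<and>
        tits_ovoid e H T \<and> C = cone_vectors q v T \<and>
        (\<exists>w. w \<noteq> 0 \<and> w $ 1 = 0 \<and> {x \<in> C. x $ 1 = 0} = proj_point w) \<and>
        g ` U = {proj_point x | x. x \<in> C \<and> x $ 1 \<noteq> 0} \<union> {{x \<in> C. x $ 1 = 0}}))"

definition U_BT :: "nat \<Rightarrow> 'a::field \<Rightarrow> ('a ^ 3) set set" where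
  "U_BT e \<epsilon> = (let q = 2 ^ (2 * e + 1) in
     {proj_point (vector [0, 0, 1])} \<union>
     {proj_point (vector [1, s + t * \<epsilon>, r + tits_fun e s t * \<epsilon>]) | r s t.
        r \<in> Fq q \<and> s \<in> Fq q \<and> t \<in> Fq q})"

text \<open>The trace from the field with \<open>2 ^ n\<close> elements to its prime field.\<close>

definition absolute_trace :: "nat \<Rightarrow> 'a::field \<Rightarrow> 'a" where
  "absolute_trace n x = (\<Sum>i<n. x ^ (2 ^ i))"

text \<open>With \<open>\<sigma> = 2 ^ (e + 1)\<close> one has \<open>\<sigma> / 2 = 2 ^ e\<close>.\<close>

definition psi :: "nat \<Rightarrow> 'a::field \<Rightarrow> 'a \<Rightarrow> ('a ^ 3) set \<Rightarrow> ('a ^ 3) set" where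
  "psi e \<epsilon> \<delta> = collineation (\<lambda>x. x ^ 2)
     (vector [vector [1, 1, \<epsilon>],
              vector [0, \<delta> ^ (2 ^ e) * (1 + \<epsilon>), \<delta> ^ (2 ^ e) * (1 + \<epsilon>)],
              vector [0, 0, \<delta> ^ (2 ^ (e + 1) + 1)]])"

end

theory Submission
  imports Defs "HOL-Algebra.Multiplicative_Group"
begin

text \<open>
  Write \<open>P\<close> for the point \<open>(0, 0, 1)\<close>. A projectivity that stabilises the unital and fixes \<open>P\<close> has a
  triangular matrix, and comparing coefficients in the equation of the unital (whose degree in each
  of the variables is less than \<open>q\<close>) shows that it is one of the \<open>q\<^sup>2\<close> matrices \<open>M\<^sub>u\<^sub>v\<close>. These act
  semiregularly on the affine part of the unital, and the elations \<open>M\<^sub>0\<^sub>v\<close> are involutions that act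
  transitively on the affine part of every secant through \<open>P\<close>. A purely permutation theoretic argument
  with conjugates of these involutions then shows that \<open>P\<close> is fixed by every projectivity that
  stabilises the unital.

  Every field automorphism is a power of the Frobenius map, so that multiplying by a power of
  \<open>\<psi>\<close> turns any collineation stabilising the unital into a projectivity. On the first affine
  coordinate \<open>\<psi>\<close> is \<open>x \<mapsto> d x\<^sup>2 + 1\<close> with \<open>d = \<delta>\<^bsup>\<sigma>/2\<^esup> (1 + \<epsilon>)\<close>; as \<open>d\<close> has absolute trace \<open>1\<close>, its
  power with exponent \<open>4 e + 2\<close> maps \<open>0\<close> to \<open>1 / d\<close> and is therefore some \<open>M\<^sub>u\<^sub>v\<close> with \<open>u \<noteq> 0\<close>,
  which has order \<open>4\<close>.
\<close>

section \<open>Points and collineations\<close>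

lemma proj_point_eq_range: "proj_point x = range (\<lambda>c. c *s x)"
  by (simp add: proj_point_def vec.span_singleton)

lemma mem_proj_point_iff: "y \<in> proj_point x \<longleftrightarrow> (\<exists>c. y = c *s x)"
  by (auto simp: proj_point_eq_range)

lemma proj_point_scale:
  assumes "c \<noteq> 0"
  shows "proj_point (c *s x) = proj_point x"
proof -
  have "k *s x = (k / c) *s (c *s x)" for k
    using assms by simp
  then have "k *s x \<in> proj_point (c *s x)" for k
    unfolding mem_proj_point_iff by blast
  moreover have "k *s (c *s x) \<in> proj_point x" for k
    by (auto simp: mem_proj_point_iff)
  ultimately show ?thesis
    unfolding mem_proj_point_iff by (auto simp: mem_proj_point_iff)
qed

lemma proj_point_eq_iff:
  assumes "x \<noteq> 0"
  shows "proj_point x = proj_point y \<longleftrightarrow> (\<exists>c. c \<noteq> 0 \<and> x = c *s y)"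
proof
  assume "proj_point x = proj_point y"
  moreover have "x \<in> proj_point x"
    unfolding mem_proj_point_iff by (rule exI[of _ 1]) simp
  ultimately obtain c where "x = c *s y"
    by (auto simp: mem_proj_point_iff)
  with assms show "\<exists>c. c \<noteq> 0 \<and> x = c *s y" by auto
qed (auto simp: proj_point_scale)

lemma proj_point_in_points [simp]: "x \<noteq> 0 \<Longrightarrow> proj_point x \<in> proj_points"
  by (auto simp: proj_points_def)

lemma proj_pointsE:
  assumes "P \<in> proj_points"
  obtains x where "x \<noteq> 0" "P = proj_point x"
  using assms by (auto simp: proj_points_def)

section \<open>Field automorphisms\<close>

lemma field_automorphismD:
  assumes "field_automorphism \<tau>"
  shows "bij \<tau>" "\<tau> (x + y) = \<tau> x + \<tau> y" "\<tau> (x * y) = \<tau> x * \<tau> y"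
  using assms by (auto simp: field_automorphism_def)

lemma field_automorphism_0: "field_automorphism \<tau> \<Longrightarrow> \<tau> 0 = 0"
  by (metis add_0 add_cancel_right_right field_automorphismD(2))

lemma field_automorphism_eq_0_iff: "field_automorphism \<tau> \<Longrightarrow> \<tau> x = 0 \<longleftrightarrow> x = 0"
  by (metis bij_is_inj field_automorphismD(1) field_automorphism_0 injD)

lemma field_automorphism_1: "field_automorphism \<tau> \<Longrightarrow> \<tau> 1 = 1"
  using field_automorphismD(3)[of \<tau> 1 1] field_automorphism_eq_0_iff[of \<tau> 1] by simp

lemma field_automorphism_sum:
  "field_automorphism \<tau> \<Longrightarrow> \<tau> (\<Sum>i\<in>I. f i) = (\<Sum>i\<in>I. \<tau> (f i))"
  by (induction I rule: infinite_finite_induct)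
     (auto simp: field_automorphism_0 field_automorphismD(2))

lemma field_automorphism_id: "field_automorphism id"
  by (simp add: field_automorphism_def)

lemma field_automorphism_comp:
  "field_automorphism \<tau> \<Longrightarrow> field_automorphism \<tau>' \<Longrightarrow> field_automorphism (\<tau> \<circ> \<tau>')"
  by (auto simp: field_automorphism_def bij_comp)

lemma field_automorphism_inv:
  assumes "field_automorphism \<tau>"
  shows "field_automorphism (inv_into UNIV \<tau>)"
  unfolding field_automorphism_def
proof (intro conjI allI)
  note \<tau> = field_automorphismD[OF assms]
  have [simp]: "\<tau> (inv_into UNIV \<tau> x) = x" for x
    using \<tau>(1) by (simp add: bij_is_surj surj_f_inv_f)
  show "bij (inv_into UNIV \<tau>)" by (rule bij_imp_bij_inv[OF \<tau>(1)])
  show "inv_into UNIV \<tau> (x + y) = inv_into UNIV \<tau> x + inv_into UNIV \<tau> y" for x y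
    by (rule inv_f_eq[OF bij_is_inj[OF \<tau>(1)]]) (simp add: \<tau>(2))
  show "inv_into UNIV \<tau> (x * y) = inv_into UNIV \<tau> x * inv_into UNIV \<tau> y" for x y
    by (rule inv_f_eq[OF bij_is_inj[OF \<tau>(1)]]) (simp add: \<tau>(3))
qed

section \<open>Semilinear maps and collineations\<close>

lemma map_matrix_mult:
  "field_automorphism \<tau> \<Longrightarrow> map_matrix \<tau> (A ** B) = map_matrix \<tau> A ** map_matrix \<tau> B"
  by (simp add: map_matrix_def matrix_matrix_mult_def field_automorphism_sum field_automorphismD(3))

lemma map_matrix_1: "field_automorphism \<tau> \<Longrightarrow> map_matrix \<tau> (mat 1) = mat 1"
  by (simp add: map_matrix_def mat_def field_automorphism_0 field_automorphism_1 vec_eq_iff)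

lemma map_matrix_invertible:
  assumes "field_automorphism \<tau>" "invertible A"
  shows "invertible (map_matrix \<tau> A)"
proof -
  obtain B where "A ** B = mat 1" "B ** A = mat 1"
    using assms(2) by (auto simp: invertible_def)
  then show ?thesis
    unfolding invertible_def
    by (metis assms(1) map_matrix_1 map_matrix_mult)
qed

lemma map_matrix_vector_mult:
  "field_automorphism \<tau> \<Longrightarrow>
   (\<chi> i. \<tau> ((x v* A) $ i)) = (\<chi> i. \<tau> (x $ i)) v* map_matrix \<tau> A"
  by (simp add: map_matrix_def vector_matrix_mult_def field_automorphism_sum field_automorphismD(3))

lemma semilinear_map_add:
  "field_automorphism \<tau> \<Longrightarrow> semilinear_map \<tau> A (x + y) = semilinear_map \<tau> A x + semilinear_map \<tau> A y"
  by (simp add: semilinear_map_def vector_matrix_mult_def vec_eq_iff field_automorphismD(2)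
      algebra_simps sum.distrib)

lemma semilinear_map_scale:
  "field_automorphism \<tau> \<Longrightarrow> semilinear_map \<tau> A (c *s x) = \<tau> c *s semilinear_map \<tau> A x"
  by (simp add: semilinear_map_def vector_matrix_mult_def vec_eq_iff field_automorphismD(3)
      sum_distrib_left algebra_simps)

text \<open>The outer automorphism passes through the inner product and acts on the entries of
  \<open>A'\<close>. Vectors are rows, so the matrix applied first stands on the left.\<close>

lemma semilinear_map_comp:
  "field_automorphism \<tau> \<Longrightarrow>
   semilinear_map \<tau> A (semilinear_map \<tau>' A' x) = semilinear_map (\<tau> \<circ> \<tau>') (map_matrix \<tau> A' ** A) x"
  by (simp add: semilinear_map_def map_matrix_vector_mult vector_matrix_mul_assoc)

lemma semilinear_map_0: "field_automorphism \<tau> \<Longrightarrow> semilinear_map \<tau> A 0 = 0"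
  using semilinear_map_scale[of \<tau> A 0 0] by (simp add: field_automorphism_0)

lemma semilinear_map_id: "semilinear_map id (mat 1) x = x"
  by (simp add: semilinear_map_def)

text \<open>The inverse has companion automorphism \<open>inv_into UNIV \<tau>\<close>, and its
  matrix is the inverse of \<open>A\<close> with that automorphism applied to every entry.\<close>

lemma semilinear_map_inverse:
  assumes "field_automorphism \<tau>" "invertible A"
  obtains B where "invertible B" "\<And>x. semilinear_map (inv_into UNIV \<tau>) B (semilinear_map \<tau> A x) = x"
    "\<And>x. semilinear_map \<tau> A (semilinear_map (inv_into UNIV \<tau>) B x) = x"
proof -
  obtain A' where A': "A ** A' = mat 1" "A' ** A = mat 1"
    using assms(2) by (auto simp: invertible_def)
  then have inv: "invertible A'" by (auto simp: invertible_def)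
  note inv\<tau> = field_automorphism_inv[OF assms(1)]
  have comp: "inv_into UNIV \<tau> \<circ> \<tau> = id" "\<tau> \<circ> inv_into UNIV \<tau> = id"
    using field_automorphismD(1)[OF assms(1)] by (auto simp: bij_is_inj bij_is_surj surj_f_inv_f fun_eq_iff)
  have [simp]: "map_matrix \<tau> (map_matrix (inv_into UNIV \<tau>) A') = A'"
    using comp(2) by (simp add: map_matrix_def fun_eq_iff)
  show ?thesis
  proof
    show "invertible (map_matrix (inv_into UNIV \<tau>) A')"
      by (rule map_matrix_invertible[OF inv\<tau> inv])
    show "semilinear_map (inv_into UNIV \<tau>) (map_matrix (inv_into UNIV \<tau>) A') (semilinear_map \<tau> A x) = x" for x
      by (simp add: semilinear_map_comp inv\<tau> comp A' map_matrix_mult[symmetric] map_matrix_1 semilinear_map_id)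
    show "semilinear_map \<tau> A (semilinear_map (inv_into UNIV \<tau>) (map_matrix (inv_into UNIV \<tau>) A') x) = x" for x
      by (simp add: semilinear_map_comp assms(1) comp A' semilinear_map_id)
  qed
qed

lemma semilinear_map_eq_0_iff:
  assumes "field_automorphism \<tau>" "invertible A"
  shows "semilinear_map \<tau> A x = 0 \<longleftrightarrow> x = 0"
  by (metis assms field_automorphism_inv semilinear_map_0 semilinear_map_inverse)

text \<open>The image of the span of \<open>x\<close> consists of the multiples
  \<open>\<tau> c\<close> of the image vector, and these are all multiples because \<tau> is
  surjective.\<close>

lemma collineation_proj_point:
  assumes "field_automorphism \<tau>" "x \<noteq> 0"
  shows "collineation \<tau> A (proj_point x) = proj_point (semilinear_map \<tau> A x)"
proof -
  have "range \<tau> = UNIV" using field_automorphismD(1)[OF assms(1)] bij_is_surj by blast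
  then have "range (\<lambda>c. \<tau> c *s semilinear_map \<tau> A x) = range (\<lambda>c. c *s semilinear_map \<tau> A x)"
    using image_image[of "\<lambda>c. c *s semilinear_map \<tau> A x" \<tau> UNIV] by simp
  then have "semilinear_map \<tau> A ` proj_point x = proj_point (semilinear_map \<tau> A x)"
    using assms(1) by (simp add: proj_point_eq_range image_image semilinear_map_scale)
  then show ?thesis
    using assms(2) by (simp add: collineation_def)
qed

lemma collineation_in_points:
  assumes "field_automorphism \<tau>" "invertible A" "P \<in> proj_points"
  shows "collineation \<tau> A P \<in> proj_points"
  using assms(3)
  by (rule proj_pointsE) (simp add: assms collineation_proj_point semilinear_map_eq_0_iff)

text \<open>Collineations are extensional functions, so values on representative vectors identify
  them; this is how products and matrices equal up to a scalar are recognised below.\<close>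

lemma collineation_eqI:
  assumes "f \<in> extensional proj_points" "field_automorphism \<tau>"
    and "\<And>x. x \<noteq> 0 \<Longrightarrow> f (proj_point x) = proj_point (semilinear_map \<tau> A x)"
  shows "f = collineation \<tau> A"
proof (rule extensionalityI[OF assms(1)])
  show "collineation \<tau> A \<in> extensional proj_points"
    by (simp add: collineation_def)
  show "f P = collineation \<tau> A P" if "P \<in> proj_points" for P
    using that by (rule proj_pointsE) (simp add: assms collineation_proj_point)
qed

lemma collineation_comp:
  assumes "field_automorphism \<tau>" "field_automorphism \<tau>'" "invertible A'"
  shows "compose proj_points (collineation \<tau> A) (collineation \<tau>' A') =
    collineation (\<tau> \<circ> \<tau>') (map_matrix \<tau> A' ** A)"
  by (rule collineation_eqI)
     (simp_all add: field_automorphism_comp assms collineation_proj_point compose_eq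
       semilinear_map_comp semilinear_map_eq_0_iff)

lemma collineation_id: "collineation id (mat 1) = (\<lambda>P\<in>proj_points. P)"
  by (rule collineation_eqI[symmetric])
     (simp_all add: field_automorphism_id semilinear_map_id)

lemma collineation_inverse:
  assumes "field_automorphism \<tau>" "invertible A"
  obtains B where "invertible B"
    "compose proj_points (collineation (inv_into UNIV \<tau>) B) (collineation \<tau> A) = (\<lambda>P\<in>proj_points. P)"
    "compose proj_points (collineation \<tau> A) (collineation (inv_into UNIV \<tau>) B) = (\<lambda>P\<in>proj_points. P)"
proof -
  note aut = assms(1) field_automorphism_inv[OF assms(1)]
  obtain B where B: "invertible B" "\<And>x. semilinear_map (inv_into UNIV \<tau>) B (semilinear_map \<tau> A x) = x"
    "\<And>x. semilinear_map \<tau> A (semilinear_map (inv_into UNIV \<tau>) B x) = x"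
    using semilinear_map_inverse[OF assms] by metis
  show ?thesis
  proof (rule that[OF B(1)])
    show "compose proj_points (collineation (inv_into UNIV \<tau>) B) (collineation \<tau> A) = (\<lambda>P\<in>proj_points. P)"
      unfolding compose_def
      by (rule restrict_ext, erule proj_pointsE)
         (simp add: collineation_proj_point aut assms B semilinear_map_eq_0_iff)
    show "compose proj_points (collineation \<tau> A) (collineation (inv_into UNIV \<tau>) B) = (\<lambda>P\<in>proj_points. P)"
      unfolding compose_def
      by (rule restrict_ext, erule proj_pointsE)
         (simp add: collineation_proj_point aut assms B semilinear_map_eq_0_iff)
  qed
qed

lemma collineation_Bij:
  assumes "field_automorphism \<tau>" "invertible A"
  shows "collineation \<tau> A \<in> Bij proj_points"
proof -
  note aut = assms(1) field_automorphism_inv[OF assms(1)]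
  obtain B where B: "invertible B"
    "compose proj_points (collineation (inv_into UNIV \<tau>) B) (collineation \<tau> A) = (\<lambda>P\<in>proj_points. P)"
    "compose proj_points (collineation \<tau> A) (collineation (inv_into UNIV \<tau>) B) = (\<lambda>P\<in>proj_points. P)"
    using collineation_inverse[OF assms] by metis
  have inv: "collineation (inv_into UNIV \<tau>) B (collineation \<tau> A P) = P"
    "collineation \<tau> A (collineation (inv_into UNIV \<tau>) B P) = P" if "P \<in> proj_points" for P
    using B(2,3)[THEN fun_cong[of _ _ P]] that by (simp_all add: compose_eq)
  have "bij_betw (collineation \<tau> A) proj_points proj_points"
    by (rule bij_betw_byWitness[of _ "collineation (inv_into UNIV \<tau>) B"])
       (auto simp: inv collineation_in_points aut assms B)
  then show ?thesis by (simp add: Bij_def collineation_def)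
qed

lemma PGammaL_simps:
  "carrier PGammaL = {collineation \<tau> A | \<tau> A. field_automorphism \<tau> \<and> invertible A}"
  "\<one>\<^bsub>PGammaL\<^esub> = (\<lambda>P\<in>proj_points. P)"
  by (simp_all add: PGammaL_def BijGroup_def)

lemma carrier_PGammaL_Bij: "carrier PGammaL \<subseteq> Bij proj_points"
  by (auto simp: PGammaL_simps collineation_Bij)

lemma PGammaL_mult:
  "g \<in> carrier PGammaL \<Longrightarrow> h \<in> carrier PGammaL \<Longrightarrow> g \<otimes>\<^bsub>PGammaL\<^esub> h = compose proj_points g h"
  using carrier_PGammaL_Bij by (auto simp: PGammaL_def BijGroup_def)

lemma collineation_in_PGammaL:
  "field_automorphism \<tau> \<Longrightarrow> invertible A \<Longrightarrow> collineation \<tau> A \<in> carrier PGammaL"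
  by (auto simp: PGammaL_simps)

lemma collineation_mult:
  assumes "field_automorphism \<tau>" "invertible A" "field_automorphism \<tau>'" "invertible A'"
  shows "collineation \<tau> A \<otimes>\<^bsub>PGammaL\<^esub> collineation \<tau>' A' =
    collineation (\<tau> \<circ> \<tau>') (map_matrix \<tau> A' ** A)"
  by (simp add: PGammaL_mult assms collineation_in_PGammaL collineation_comp)

lemma group_PGammaL: "group (PGammaL :: (('a::field ^ 3) set \<Rightarrow> _) monoid)"
proof -
  let ?\<Gamma> = "PGammaL :: (('a ^ 3) set \<Rightarrow> _) monoid"
  have "subgroup (carrier ?\<Gamma>) (BijGroup proj_points)"
  proof (rule group.subgroupI[OF group_BijGroup])
    show "carrier ?\<Gamma> \<subseteq> carrier (BijGroup proj_points)"
      using carrier_PGammaL_Bij by (simp add: BijGroup_def)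
    show "carrier ?\<Gamma> \<noteq> {}"
      using collineation_in_PGammaL[OF field_automorphism_id, of "mat 1"] by (force simp: invertible_def)
  next
    fix g assume "g \<in> carrier ?\<Gamma>"
    then obtain \<tau> A where g: "g = collineation \<tau> A" "field_automorphism \<tau>" "invertible A"
      by (auto simp: PGammaL_simps)
    note aut = g(2) field_automorphism_inv[OF g(2)]
    obtain B where B: "invertible B"
      "compose proj_points (collineation (inv_into UNIV \<tau>) B) g = (\<lambda>P\<in>proj_points. P)"
      using collineation_inverse[OF g(2,3)] unfolding g(1) by metis
    have "inv\<^bsub>BijGroup proj_points\<^esub> g = collineation (inv_into UNIV \<tau>) B"
      by (rule group.inv_equality[OF group_BijGroup])
         (use B g aut in \<open>auto simp: BijGroup_def collineation_Bij\<close>)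
    then show "inv\<^bsub>BijGroup proj_points\<^esub> g \<in> carrier ?\<Gamma>"
      by (simp add: collineation_in_PGammaL aut B)
  next
    fix g h assume gh: "g \<in> carrier ?\<Gamma>" "h \<in> carrier ?\<Gamma>"
    then obtain \<tau> A \<tau>' A' where g: "g = collineation \<tau> A" "field_automorphism \<tau>" "invertible A"
      and h: "h = collineation \<tau>' A'" "field_automorphism \<tau>'" "invertible A'"
      by (auto simp: PGammaL_simps)
    have "g \<otimes>\<^bsub>BijGroup proj_points\<^esub> h = compose proj_points g h"
      using gh carrier_PGammaL_Bij by (auto simp: BijGroup_def)
    then show "g \<otimes>\<^bsub>BijGroup proj_points\<^esub> h \<in> carrier ?\<Gamma>"
      by (simp add: g h collineation_comp collineation_in_PGammaL field_automorphism_comp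
          invertible_mult map_matrix_invertible)
  qed
  then have "group (BijGroup proj_points\<lparr>carrier := carrier ?\<Gamma>\<rparr>)"
    by (rule subgroup.subgroup_is_group[OF _ group_BijGroup])
  then show ?thesis by (simp add: PGammaL_def)
qed

lemma PGammaL_apply_mult:
  "g \<in> carrier PGammaL \<Longrightarrow> h \<in> carrier PGammaL \<Longrightarrow> P \<in> proj_points \<Longrightarrow>
   (g \<otimes>\<^bsub>PGammaL\<^esub> h) P = g (h P)"
  by (simp add: PGammaL_mult compose_eq)

section \<open>Projectivities and the companion automorphism of a collineation\<close>

lemma carrier_PGL: "carrier PGL = {collineation id A | A. invertible A}"
  by (simp add: PGL_def)

lemma carrier_PGL_subset: "carrier PGL \<subseteq> carrier PGammaL"
  by (auto simp: carrier_PGL PGammaL_simps intro: field_automorphism_id)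

text \<open>A collineation determines its companion automorphism: compare the images of
  \<open>e\<^sub>1\<close>, \<open>e\<^sub>2\<close> and \<open>e\<^sub>1 + c e\<^sub>2\<close>.\<close>

lemma collineation_automorphism_unique:
  assumes "field_automorphism \<tau>" "invertible A" "field_automorphism \<tau>'" "invertible A'"
    and eq: "collineation \<tau> A = collineation \<tau>' A'"
  shows "\<tau> = \<tau>'"
proof
  fix c
  define f where "f = semilinear_map \<tau> A"
  define f' where "f' = semilinear_map \<tau>' A'"
  define a b :: "'a ^ 3" where "a = axis 1 1" and "b = axis 2 1"
  have scal: "\<exists>k. k \<noteq> 0 \<and> f x = k *s f' x" if "x \<noteq> 0" for x
    using fun_cong[OF eq, of "proj_point x"] that assms(1-4)
    by (simp add: collineation_proj_point f_def f'_def proj_point_eq_iff semilinear_map_eq_0_iff)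
  \<comment> \<open>The images of \<open>a\<close> and \<open>b\<close> under \<open>f'\<close> stay
    independent: scalars are pulled back along the surjective \<open>\<tau>'\<close>, and
    \<open>f'\<close> has trivial kernel.\<close>
  have ind: "r = 0 \<and> s = 0" if "r *s f' a + s *s f' b = 0" for r s
  proof -
    obtain r' s' where r': "r = \<tau>' r'" "s = \<tau>' s'"
      using field_automorphismD(1)[OF assms(3)] by (meson bij_is_surj surj_def)
    have "f' (r' *s a + s' *s b) = 0"
      using that assms(3) by (simp add: r' f'_def semilinear_map_add semilinear_map_scale)
    then have "r' *s a + s' *s b = 0"
      using assms(3,4) by (simp add: f'_def semilinear_map_eq_0_iff)
    then have "(r' *s a + s' *s b) $ 1 = 0 \<and> (r' *s a + s' *s b) $ 2 = 0" by simp
    then have "r' = 0 \<and> s' = 0" by (simp add: a_def b_def axis_def)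
    then show ?thesis using r' field_automorphism_0[OF assms(3)] by simp
  qed
  have nz: "a \<noteq> 0" "b \<noteq> 0" "a + k *s b \<noteq> 0" for k
  proof -
    have "(a + k *s b) $ 1 = 1" by (simp add: a_def b_def axis_def)
    then show "a + k *s b \<noteq> 0" by (metis zero_index zero_neq_one)
  qed (auto simp: a_def b_def axis_eq_0_iff)
  obtain ka kb where ka: "f a = ka *s f' a" "ka \<noteq> 0" and kb: "f b = kb *s f' b"
    using scal nz by metis
  have key: "\<tau> c * kb = ka * \<tau>' c" for c
  proof -
    obtain k where "f (a + c *s b) = k *s f' (a + c *s b)" using scal nz by metis
    then have "ka *s f' a + (\<tau> c * kb) *s f' b = k *s f' a + (k * \<tau>' c) *s f' b"
      using assms ka kb
      by (simp add: f_def f'_def semilinear_map_add semilinear_map_scale vector_add_ldistrib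
          vector_smult_assoc)
    then have "(ka - k) *s f' a + (\<tau> c * kb - k * \<tau>' c) *s f' b = 0"
      by (simp add: vec_eq_iff algebra_simps)
    from ind[OF this] show ?thesis by simp
  qed
  \<comment> \<open>The value 1 is fixed by both automorphisms, so this instance identifies the two
    scaling factors, which then cancel for general \<open>c\<close>.\<close>
  from key[of 1] assms have "kb = ka" by (simp add: field_automorphism_1)
  with key[of c] ka(2) show "\<tau> c = \<tau>' c" by simp
qed

section \<open>Automorphisms of a finite field of characteristic two\<close>

lemma field_automorphism_diff: "field_automorphism \<tau> \<Longrightarrow> \<tau> (x - y) = \<tau> x - \<tau> y"
  using field_automorphismD(2)[of \<tau> "x - y" y] by (simp add: eq_diff_eq)

lemma field_automorphism_divide: "field_automorphism \<tau> \<Longrightarrow> \<tau> (x / y) = \<tau> x / \<tau> y"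
proof (cases "y = 0")
  case False
  assume \<tau>: "field_automorphism \<tau>"
  have "\<tau> (x / y) * \<tau> y = \<tau> x"
    using field_automorphismD(3)[OF \<tau>, of "x / y" y] False by simp
  then show ?thesis
    using False by (simp add: nonzero_eq_divide_eq field_automorphism_eq_0_iff \<tau>)
qed (simp add: field_automorphism_0)

lemma poly_map_poly_automorphism:
  assumes "field_automorphism \<tau>"
  shows "poly (map_poly \<tau> p) (\<tau> x) = \<tau> (poly p x)"
  using assms
  by (induction p) (simp_all add: map_poly_pCons field_automorphism_0 field_automorphismD)

lemma map_poly_automorphism_mult:
  assumes "field_automorphism \<tau>"
  shows "map_poly \<tau> (p * q) = map_poly \<tau> p * map_poly \<tau> q"
  using field_automorphism_0[OF assms]
  by (intro poly_eqI)
     (simp add: coeff_map_poly coeff_mult field_automorphism_sum field_automorphismD assms)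

lemma map_poly_automorphism_prod:
  assumes "field_automorphism \<tau>"
  shows "map_poly \<tau> (\<Prod>i\<in>I. f i) = (\<Prod>i\<in>I. map_poly \<tau> (f i))"
  by (induction I rule: infinite_finite_induct)
     (simp_all add: field_automorphism_1 map_poly_automorphism_mult assms)

text \<open>Distinct automorphisms agree on a proper subfield \<open>V\<close>, and for \<open>w \<notin> V\<close> the map
  \<open>(a, b) \<mapsto> a + b w\<close> is injective on \<open>V \<times> V\<close>.\<close>

lemma card_equaliser_automorphisms:
  fixes \<tau> \<rho> :: "'a::finite_field \<Rightarrow> 'a"
  assumes "field_automorphism \<tau>" "field_automorphism \<rho>" "\<tau> \<noteq> \<rho>"
  shows "card {x. \<tau> x = \<rho> x} ^ 2 \<le> CARD('a)"
proof -
  define V where "V = {x. \<tau> x = \<rho> x}"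
  have V: "x - y \<in> V" "x / y \<in> V" if "x \<in> V" "y \<in> V" for x y
    using that assms(1,2) by (simp_all add: V_def field_automorphism_diff field_automorphism_divide)
  obtain w where w: "w \<notin> V" using assms(3) by (auto simp: V_def)
  have "inj_on (\<lambda>(a, b). a + b * w) (V \<times> V)"
  proof (clarsimp simp: inj_on_def)
    fix a b a' b' assume *: "a \<in> V" "b \<in> V" "a' \<in> V" "b' \<in> V" "a + b * w = a' + b' * w"
    have "b = b'"
    proof (rule ccontr)
      assume "b \<noteq> b'"
      with *(5) have "w = (a' - a) / (b - b')" by (simp add: field_simps)
      moreover have "(a' - a) / (b - b') \<in> V" by (intro V *)
      ultimately show False using w by simp
    qed
    with * show "a = a' \<and> b = b'" by simp
  qed
  then have "card (V \<times> V) \<le> CARD('a)"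
    by (metis card_inj_on_le finite subset_UNIV)
  then show ?thesis by (simp add: V_def card_cartesian_product power2_eq_square)
qed

text \<open>Raising to the power \<open>CARD('a)\<close> fixes every element, but an even exponent
  turns -1 into 1.\<close>

lemma two_eq_0_if_even_card:
  assumes "even CARD('a::finite_field)"
  shows "(2 :: 'a) = 0"
proof -
  have "(- 1 :: 'a) = 1"
    using finite_field_power_card_eq_same[of "- 1 :: 'a"] assms by simp
  then have "(1 :: 'a) + 1 = - 1 + 1" by simp
  then show ?thesis by simp
qed

section \<open>The Frobenius map in characteristic two\<close>

context
  assumes char_two: "(2 :: 'a::finite_field) = 0"
begin

lemma double_eq_0: "x + x = (0 :: 'a)"
  using char_two by (simp flip: mult_2)

lemma uminus_eq: "- x = (x :: 'a)"
  by (rule minus_unique[OF double_eq_0])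

lemma frobenius_add: "((x :: 'a) + y) ^ 2 ^ k = x ^ 2 ^ k + y ^ 2 ^ k"
proof (induction k arbitrary: x y)
  case (Suc k)
  have "(x + y) ^ 2 = x ^ 2 + y ^ 2"
    by (simp add: power2_sum char_two)
  then show ?case by (simp add: power_mult Suc)
qed simp

text \<open>The map is additive with trivial kernel, hence injective, and an injective self-map of a
  finite field is bijective.\<close>

lemma field_automorphism_frobenius: "field_automorphism (\<lambda>x :: 'a. x ^ 2 ^ k)"
proof -
  have "inj (\<lambda>x :: 'a. x ^ 2 ^ k)"
  proof (rule injI)
    fix x y :: 'a assume "x ^ 2 ^ k = y ^ 2 ^ k"
    then have "(x + y) ^ 2 ^ k = 0" by (simp add: frobenius_add double_eq_0)
    then have "x + y = 0" by simp
    then have "x = - y" by (simp add: eq_neg_iff_add_eq_0)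
    then show "x = y" by (simp add: uminus_eq)
  qed
  then have "bij (\<lambda>x :: 'a. x ^ 2 ^ k)"
    by (simp add: finite_UNIV_inj_surj bij_def)
  then show ?thesis
    by (simp add: field_automorphism_def frobenius_add power_mult_distrib)
qed

text \<open>Squaring permutes the factors of the product of all X + \<open>x ^ 2 ^ i\<close>
  cyclically. Its coefficients therefore equal their squares, so they are 0 or 1 and are fixed by
  \<tau>. Hence \<tau> maps the root \<open>x\<close> to a root.\<close>

lemma automorphism_conjugate:
  assumes "CARD('a) = 2 ^ n" and \<tau>: "field_automorphism (\<tau> :: 'a \<Rightarrow> 'a)"
  shows "\<exists>i<n. \<tau> x = x ^ 2 ^ i"
proof -
  define p where "p = (\<Prod>i<n. [:x ^ 2 ^ i, 1:])"
  have sq: "field_automorphism (\<lambda>x :: 'a. x ^ 2)"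
    using field_automorphism_frobenius[of 1] by simp
  have "n \<noteq> 0"
  proof
    assume "n = 0"
    then obtain z :: 'a where "UNIV = {z}" using assms(1) by (auto simp: card_1_singleton_iff)
    then show False by (metis UNIV_I singletonD zero_neq_one)
  qed
  have x: "x ^ 2 ^ n = x"
    using finite_field_power_card_eq_same[of x] assms(1) by simp
  have "map_poly (\<lambda>x. x ^ 2) p = (\<Prod>i<n. [:x ^ 2 ^ Suc i, 1:])"
    unfolding p_def map_poly_automorphism_prod[OF sq]
    by (rule prod.cong) (simp_all add: map_poly_pCons power_mult[symmetric] mult.commute)
  also have "\<dots> = p"
  proof (cases n)
    case (Suc m)
    then show ?thesis
      using prod.lessThan_Suc_shift[of "\<lambda>i. [:x ^ 2 ^ i, 1:]" m]
        prod.lessThan_Suc[of "\<lambda>i. [:x ^ 2 ^ Suc i, 1:]" m] x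
      by (simp add: p_def del: prod.lessThan_Suc mult_pCons_left mult_pCons_right)
  qed (simp add: p_def)
  finally have "Polynomial.coeff (map_poly (\<lambda>x. x ^ 2) p) i = Polynomial.coeff p i" for i by simp
  then have "Polynomial.coeff p i ^ 2 = Polynomial.coeff p i" for i by (simp add: coeff_map_poly)
  then have "Polynomial.coeff p i = 0 \<or> Polynomial.coeff p i = 1" for i
    unfolding power2_eq_square by (simp add: mult_cancel_left2)
  then have "\<tau> (Polynomial.coeff p i) = Polynomial.coeff p i" for i
    using field_automorphism_0[OF \<tau>] field_automorphism_1[OF \<tau>] by metis
  then have "map_poly \<tau> p = p"
    by (intro poly_eqI) (simp add: coeff_map_poly field_automorphism_0 \<tau>)
  moreover have "poly p x = 0"
    using \<open>n \<noteq> 0\<close> by (auto simp: p_def poly_prod double_eq_0 intro!: bexI[of _ 0])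
  ultimately have "poly p (\<tau> x) = 0"
    using poly_map_poly_automorphism[OF \<tau>, of p x] by (simp add: field_automorphism_0 \<tau>)
  then show ?thesis by (auto simp: p_def poly_prod add_eq_0_iff uminus_eq)
qed

text \<open>The \<open>2 m\<close> equalisers of \<open>\<tau>\<close> with the powers of the Frobenius map cover the field, so
  they cannot all be proper subfields, which have at most \<open>2\<^sup>m\<close> elements.\<close>

lemma automorphism_eq_frobenius_power:
  assumes card: "CARD('a) = (2 ^ m)\<^sup>2" and m: "2 * m < 2 ^ m"
    and \<tau>: "field_automorphism (\<tau> :: 'a \<Rightarrow> 'a)"
  shows "\<exists>i<2 * m. \<tau> = (\<lambda>x. x ^ 2 ^ i)"
proof (rule ccontr)
  assume contra: "\<not> ?thesis"
  define V where "V i = {x. \<tau> x = x ^ 2 ^ i}" for i :: nat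
  have V: "card (V i) \<le> 2 ^ m" if "i < 2 * m" for i
  proof -
    have "card (V i) ^ 2 \<le> (2 ^ m)\<^sup>2"
      unfolding V_def card[symmetric]
      by (rule card_equaliser_automorphisms[OF \<tau> field_automorphism_frobenius])
         (use contra that in blast)
    then show ?thesis by (simp add: power2_nat_le_eq_le)
  qed
  have "CARD('a) = 2 ^ (2 * m)" using card by (simp add: power_mult[symmetric] mult.commute)
  then have "UNIV = (\<Union>i<2 * m. V i)"
    using automorphism_conjugate[OF _ \<tau>] by (auto simp: V_def)
  then have "CARD('a) \<le> (\<Sum>i<2 * m. card (V i))"
    using card_UN_le[of "{..<2 * m}" V] by simp
  also have "\<dots> \<le> (\<Sum>i<2 * m. 2 ^ m)" by (rule sum_mono) (use V in simp)
  also have "\<dots> < (2 ^ m)\<^sup>2" using m by (simp add: power2_eq_square)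
  finally show False using card by simp
qed

end

section \<open>Arithmetic of the quadratic extension\<close>

locale tits_setting =
  fixes e q :: nat and \<epsilon> \<delta> :: "'a::finite_field"
  assumes e_ge_1: "e \<ge> 1" and q_eq: "q = 2 ^ (2 * e + 1)" and card_UNIV_eq: "CARD('a) = q ^ 2"
    and eps_pow_q: "\<epsilon> ^ q = \<epsilon> + 1" and eps_square: "\<epsilon> ^ 2 = \<epsilon> + \<delta>"
    and delta_Fq: "\<delta> \<in> Fq q" and trace_delta: "absolute_trace (2 * e + 1) \<delta> = 1"
begin

lemma char_two: "(2 :: 'a) = 0"
  by (rule two_eq_0_if_even_card) (simp add: card_UNIV_eq q_eq)

lemma add_self [simp]: "x + x = (0 :: 'a)" "x + (x + y) = (y :: 'a)"
  by (simp_all add: double_eq_0[OF char_two] flip: add.assoc)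

lemma minus_eq: "- x = (x :: 'a)"
  by (rule uminus_eq[OF char_two])

lemma add_eq_0_iff_eq: "x + y = 0 \<longleftrightarrow> x = (y :: 'a)"
  by (simp add: eq_neg_iff_add_eq_0[symmetric] minus_eq)

lemma square_add: "(x + y)\<^sup>2 = x\<^sup>2 + (y :: 'a)\<^sup>2"
  using frobenius_add[OF char_two, of x y 1] by simp

definition conj :: "'a \<Rightarrow> 'a" where
  "conj x = x ^ q"

text \<open>The Tits automorphism: on \<open>Fq q\<close> its square is the squaring map, as 2 ^ (2
  e + 2) = 2 q.\<close>

definition sigma :: "'a \<Rightarrow> 'a" where
  "sigma x = x ^ 2 ^ (e + 1)"

text \<open>The relative trace to \<open>Fq q\<close>. It vanishes on \<open>Fq q\<close> and takes
  the value 1 at \<epsilon>, so it reads off the coefficient of \<epsilon>.\<close>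

definition im :: "'a \<Rightarrow> 'a" where
  "im x = conj x + x"

definition re :: "'a \<Rightarrow> 'a" where
  "re x = x + im x * \<epsilon>"

lemma conj_automorphism: "field_automorphism conj"
proof -
  have "conj = (\<lambda>x. x ^ 2 ^ (2 * e + 1))" by (rule ext, unfold conj_def) (simp add: q_eq)
  then show ?thesis by (simp only: field_automorphism_frobenius[OF char_two])
qed

lemma sigma_automorphism: "field_automorphism sigma"
  unfolding sigma_def[abs_def] by (rule field_automorphism_frobenius[OF char_two])

lemmas conj_simps [simp] = field_automorphismD(2,3)[OF conj_automorphism]
  field_automorphism_0[OF conj_automorphism] field_automorphism_1[OF conj_automorphism]

lemmas sigma_simps [simp] = field_automorphismD(2,3)[OF sigma_automorphism]
  field_automorphism_0[OF sigma_automorphism] field_automorphism_1[OF sigma_automorphism]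
  field_automorphism_eq_0_iff[OF sigma_automorphism]

lemma conj_power [simp]: "conj (x ^ k) = conj x ^ k"
  by (simp add: conj_def power_mult[symmetric] mult.commute)

lemma sigma_power [simp]: "sigma (x ^ k) = sigma x ^ k"
  by (simp add: sigma_def power_mult[symmetric] mult.commute)

lemma conj_conj [simp]: "conj (conj x) = x"
  using finite_field_power_card_eq_same[of x]
  by (simp add: conj_def power_mult[symmetric] card_UNIV_eq power2_eq_square)

lemma conj_eps [simp]: "conj \<epsilon> = \<epsilon> + 1"
  by (simp add: conj_def eps_pow_q)

lemma eps_mult_eps: "\<epsilon> * \<epsilon> = \<epsilon> + \<delta>"
  using eps_square by (simp add: power2_eq_square)

lemma mem_Fq_iff: "x \<in> Fq q \<longleftrightarrow> conj x = x"
  by (simp add: Fq_def conj_def)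

lemma Fq_closed [simp]:
  "(0 :: 'a) \<in> Fq q" "(1 :: 'a) \<in> Fq q" "\<delta> \<in> Fq q"
  "x \<in> Fq q \<Longrightarrow> y \<in> Fq q \<Longrightarrow> x + y \<in> (Fq q :: 'a set)" "x \<in> Fq q \<Longrightarrow> y \<in> Fq q \<Longrightarrow> x * y \<in> (Fq q :: 'a set)"
  "x \<in> Fq q \<Longrightarrow> x ^ k \<in> (Fq q :: 'a set)" "x \<in> Fq q \<Longrightarrow> sigma x \<in> Fq q"
  using delta_Fq by (auto simp: mem_Fq_iff sigma_def)

lemma tits_fun_eq: "tits_fun e s t = sigma s * s\<^sup>2 + sigma t + s * t"
  by (simp add: tits_fun_def sigma_def power_add power2_eq_square)

lemma tits_fun_Fq [simp]: "s \<in> Fq q \<Longrightarrow> t \<in> Fq q \<Longrightarrow> tits_fun e s t \<in> (Fq q :: 'a set)"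
  by (simp add: tits_fun_eq)

lemma im_Fq [simp]: "im x \<in> Fq q"
  by (simp add: mem_Fq_iff im_def add.commute)

lemma re_Fq [simp]: "re x \<in> Fq q"
proof -
  have "conj (im x) = im x" using im_Fq by (simp add: mem_Fq_iff)
  then show ?thesis
    by (simp add: mem_Fq_iff re_def algebra_simps) (simp add: im_def add_ac)
qed

lemma re_im: "x = re x + im x * \<epsilon>"
  by (simp add: re_def add.assoc)

lemma im_eq_0_iff: "im x = 0 \<longleftrightarrow> x \<in> Fq q"
  by (simp add: im_def mem_Fq_iff add_eq_0_iff_eq)

lemma im_add: "im (x + y) = im x + im y"
  by (simp add: im_def add_ac)

lemma im_coords [simp]: "s \<in> Fq q \<Longrightarrow> t \<in> Fq q \<Longrightarrow> im (s + t * \<epsilon>) = t"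
  by (simp add: im_def mem_Fq_iff algebra_simps)

lemma re_coords [simp]: "s \<in> Fq q \<Longrightarrow> t \<in> Fq q \<Longrightarrow> re (s + t * \<epsilon>) = s"
  unfolding re_def[of "s + t * \<epsilon>"] by (subst im_coords) (simp_all add: add.assoc)

lemma coordsE:
  obtains s t where "s \<in> Fq q" "t \<in> Fq q" "x = s + t * \<epsilon>"
  using re_im re_Fq im_Fq by blast

lemma coords_mult:
  "(a + c * \<epsilon>) * (s + t * \<epsilon>) = (a * s + c * t * \<delta>) + (a * t + c * s + c * t) * \<epsilon>"
proof -
  have "(a + c * \<epsilon>) * (s + t * \<epsilon>) = a * s + (a * t + c * s) * \<epsilon> + c * t * (\<epsilon> * \<epsilon>)"
    by (simp add: algebra_simps)
  then show ?thesis unfolding eps_mult_eps by (simp add: algebra_simps)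
qed

text \<open>The coordinates \<open>re\<close> and \<open>im\<close> identify the field, which has
  \<open>q ^ 2\<close> elements, with the pairs over \<open>Fq q\<close>.\<close>

lemma card_Fq: "card (Fq q :: 'a set) = q"
proof -
  have "bij_betw (\<lambda>(s, t). s + t * \<epsilon>) (Fq q \<times> Fq q) UNIV"
    by (rule bij_betw_byWitness[of _ "\<lambda>x. (re x, im x)"]) (simp_all add: split_beta image_subset_iff flip: re_im)
  then have "card (Fq q \<times> Fq q :: ('a \<times> 'a) set) = q\<^sup>2"
    by (metis bij_betw_same_card card_UNIV_eq)
  then show ?thesis by (simp add: card_cartesian_product power2_eq_square)
      (metis power2_eq_square power2_eq_iff_nonneg zero_le)
qed

text \<open>The first bound keeps the exponents of the Tits function apart from 2, 1 and 0. The
  second keeps the degree below the number of elements of \<open>Fq q\<close>, so that coefficients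
  may be compared.\<close>

lemma sigma_bounds: "4 \<le> (2 :: nat) ^ (e + 1)" "2 ^ (e + 1) + 2 < q"
proof -
  have "(2 :: nat) ^ 2 \<le> 2 ^ (e + 1)" using e_ge_1 by (intro power_increasing) auto
  then show *: "4 \<le> (2 :: nat) ^ (e + 1)" by simp
  have "2 ^ 1 \<le> (2 :: nat) ^ e" using e_ge_1 by (intro power_increasing) auto
  then have "(2 :: nat) ^ (e + 1) * 2 \<le> 2 ^ (e + 1) * 2 ^ e" by simp
  also have "\<dots> = 2 ^ (e + 1 + e)" by (simp only: power_add)
  also have "\<dots> = q" by (simp add: q_eq mult_2)
  finally show "2 ^ (e + 1) + 2 < q" using * by linarith
qed

text \<open>The exponents \<open>\<sigma> + 2, \<sigma>, 2, 1, 0\<close> are distinct and less than \<open>q\<close>.\<close>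

lemma sigma_polynomial_eq_0:
  assumes "\<And>t. t \<in> Fq q \<Longrightarrow> a * (sigma t * t\<^sup>2) + b * sigma t + c * t\<^sup>2 + d * t + k = 0"
  shows "a = 0" "b = 0" "c = 0" "d = 0" "k = 0"
proof -
  define s :: nat where "s = 2 ^ (e + 1)"
  have s: "4 \<le> s" "s + 2 < q" using sigma_bounds by (simp_all add: s_def)
  define p where "p = Polynomial.monom a (s + 2) + Polynomial.monom b s +
    Polynomial.monom c 2 + Polynomial.monom d 1 + Polynomial.monom k 0"
  have "poly p t = a * (sigma t * t\<^sup>2) + b * sigma t + c * t\<^sup>2 + d * t + k" for t
    by (simp add: p_def poly_monom sigma_def s_def power_add power2_eq_square)
  then have "Fq q \<subseteq> {t. poly p t = 0}" using assms by auto
  then have "q \<le> card {t. poly p t = 0}"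
    by (metis card_Fq card_mono finite)
  moreover have "Polynomial.degree p \<le> s + 2"
    unfolding p_def using s(1)
    by (intro degree_add_le order.trans[OF degree_monom_le]) auto
  ultimately have "p = 0"
    using card_poly_roots_bound[of p] s(2) by (cases "p = 0") auto
  then have "Polynomial.coeff p i = 0" for i by simp
  from this[of "s + 2"] this[of s] this[of 2] this[of 1] this[of 0] s(1)
  show "a = 0" "b = 0" "c = 0" "d = 0" "k = 0"
    by (simp_all add: p_def split: if_splits)
qed

section \<open>Affine maps preserving the equation of the unital\<close>

lemma delta_nonzero: "\<delta> \<noteq> 0"
  using trace_delta by (auto simp: absolute_trace_def power_0_left simp del: sum.lessThan_Suc)

text \<open>Comparing coefficients on the two axes \<open>s = 0\<close> and \<open>t = 0\<close> is enough.\<close>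

lemma affine_symmetries:
  assumes \<alpha>: "\<alpha> \<noteq> 0"
    and pres: "\<And>x z. im z = tits_fun e (re x) (im x) \<Longrightarrow>
      im (\<gamma> * z + \<rho> * x + \<tau>) = tits_fun e (re (\<alpha> * x + \<beta>)) (im (\<alpha> * x + \<beta>))"
  obtains u v where "u \<in> Fq q" "v \<in> Fq q" "\<alpha> = 1" "\<gamma> = 1" "\<beta> = u * \<epsilon>" "\<rho> = u + u * \<epsilon>"
    "\<tau> = v + sigma u * \<epsilon>"
proof -
  obtain a c where ac: "a \<in> Fq q" "c \<in> Fq q" "\<alpha> = a + c * \<epsilon>" by (rule coordsE)
  obtain s0 t0 where st0: "s0 \<in> Fq q" "t0 \<in> Fq q" "\<beta> = s0 + t0 * \<epsilon>" by (rule coordsE)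
  obtain r1 r2 where r: "r1 \<in> Fq q" "r2 \<in> Fq q" "\<rho> = r1 + r2 * \<epsilon>" by (rule coordsE)
  obtain v w where vw: "v \<in> Fq q" "w \<in> Fq q" "\<tau> = v + w * \<epsilon>" by (rule coordsE)
  have zero: "re 0 = 0" "im 0 = 0" "im 1 = 0" by (simp_all add: re_def im_def)
  \<comment> \<open>The points with \<open>x = 0\<close> and \<open>z = 0\<close> or
    \<open>z = 1\<close> both satisfy the equation, and the right-hand side of \<open>pres\<close>
    depends on \<open>x\<close> only.\<close>
  have "im (\<gamma> * 0 + \<rho> * 0 + \<tau>) = im (\<gamma> * 1 + \<rho> * 0 + \<tau>)"
    using pres[where z = 0 and x = 0] pres[where z = 1 and x = 0] by (simp add: zero im_add tits_fun_eq)
  then have "im \<gamma> = 0" by (simp add: zero im_add)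
  then have \<gamma>: "\<gamma> \<in> Fq q" by (simp add: im_eq_0_iff)
  \<comment> \<open>This is \<open>pres\<close> in coordinates, for \<open>z\<close> with
    \<open>re z = 0\<close>; two equal elements have sum 0 in characteristic two.\<close>
  have eq: "\<gamma> * tits_fun e s t + (r2 * s + (r1 + r2) * t) + w +
      tits_fun e (a * s + c * \<delta> * t + s0) (c * s + (a + c) * t + t0) = 0"
    if st: "s \<in> Fq q" "t \<in> Fq q" for s t :: 'a
  proof -
    have 1: "\<alpha> * (s + t * \<epsilon>) + \<beta> = (a * s + c * \<delta> * t + s0) + (c * s + (a + c) * t + t0) * \<epsilon>"
      unfolding ac st0 coords_mult by (simp add: algebra_simps)
    have 2: "\<gamma> * (0 + tits_fun e s t * \<epsilon>) + \<rho> * (s + t * \<epsilon>) + \<tau> =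
      (r1 * s + r2 * t * \<delta> + v) + (\<gamma> * tits_fun e s t + (r2 * s + (r1 + r2) * t) + w) * \<epsilon>"
      unfolding r vw coords_mult by (simp add: algebra_simps)
    have "im (0 + tits_fun e s t * \<epsilon>) = tits_fun e (re (s + t * \<epsilon>)) (im (s + t * \<epsilon>))"
      using st by (simp only: im_coords re_coords Fq_closed tits_fun_Fq)
    from pres[OF this] show ?thesis
      unfolding 1 2 add_eq_0_iff_eq
      using st ac(1,2) st0(1,2) r(1,2) vw(1,2) \<gamma>
      by (simp only: im_coords re_coords Fq_closed tits_fun_Fq)
  qed
  \<comment> \<open>On the axis \<open>s = 0\<close> this is the leading coefficient. The other four
    are written out only to match the shape that \<open>sigma_polynomial_eq_0\<close>
    expects.\<close>
  have "sigma (c * \<delta>) * (c * \<delta>)\<^sup>2 = 0"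
  proof (rule sigma_polynomial_eq_0(1))
    fix t :: 'a assume "t \<in> Fq q"
    from eq[OF Fq_closed(1) this]
    show "sigma (c * \<delta>) * (c * \<delta>)\<^sup>2 * (sigma t * t\<^sup>2)
      + (sigma (c * \<delta>) * s0\<^sup>2 + sigma (a + c) + \<gamma>) * sigma t
      + (sigma s0 * (c * \<delta>)\<^sup>2 + c * \<delta> * (a + c)) * t\<^sup>2
      + (c * \<delta> * t0 + s0 * (a + c) + r1 + r2) * t + (sigma s0 * s0\<^sup>2 + sigma t0 + s0 * t0 + w) = 0"
      by (simp add: tits_fun_eq square_add power_mult_distrib algebra_simps power2_eq_square)
  qed
  then have c: "c = 0" using delta_nonzero by simp
  then have a: "a \<noteq> 0" using \<alpha> ac by simp
  have on_t_0: "(sigma a * a\<^sup>2 + \<gamma>) * (sigma s * s\<^sup>2) + sigma a * s0\<^sup>2 * sigma s + sigma s0 * a\<^sup>2 * s\<^sup>2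
      + (a * t0 + r2) * s + (sigma s0 * s0\<^sup>2 + sigma t0 + s0 * t0 + w) = 0"
    if "s \<in> Fq q" for s :: 'a
    using eq[OF that Fq_closed(1)] unfolding c
    by (simp add: tits_fun_eq square_add power_mult_distrib algebra_simps power2_eq_square)
  note coeffs = sigma_polynomial_eq_0[OF on_t_0]
  from coeffs(2) have s0: "s0 = 0" using a by simp
  have on_s_0: "0 * (sigma t * t\<^sup>2) + (\<gamma> + sigma a) * sigma t + 0 * t\<^sup>2 + (r1 + r2) * t + (w + sigma t0) = 0"
    if "t \<in> Fq q" for t :: 'a
    using eq[OF Fq_closed(1) that] unfolding c s0
    by (simp add: tits_fun_eq square_add power_mult_distrib algebra_simps power2_eq_square)
  note coeffs' = sigma_polynomial_eq_0(2)[OF on_s_0] sigma_polynomial_eq_0(4)[OF on_s_0]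
  \<comment> \<open>The two axes give \<gamma> = \<open>sigma a * a\<^sup>2\<close> and \<gamma> =
    \<open>sigma a\<close>; in characteristic two, \<open>a\<^sup>2 = 1\<close> means
    \<open>a = 1\<close>.\<close>
  from coeffs'(1) have "sigma a * (a + 1)\<^sup>2 = 0"
    using coeffs(1) by (simp add: square_add add_eq_0_iff_eq algebra_simps)
  then have a1: "a = 1" using a by (simp add: add_eq_0_iff_eq)
  show thesis
  proof (rule that[of t0 v])
    show "\<alpha> = 1" using ac c a1 by simp
    show "\<gamma> = 1" using coeffs'(1) a1 by (simp add: add_eq_0_iff_eq)
    show "\<beta> = t0 * \<epsilon>" using st0 s0 by simp
    show "\<rho> = t0 + t0 * \<epsilon>" using r coeffs(4) coeffs'(2) a1 by (simp add: add_eq_0_iff_eq)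
    show "\<tau> = v + sigma t0 * \<epsilon>" using vw coeffs(5) s0 by (simp add: add_eq_0_iff_eq)
  qed (use st0 vw in auto)
qed

end

section \<open>Fixing a point by conjugating involutions\<close>

text \<open>Suppose \<open>g\<close> moves \<open>P\<close> to \<open>Q\<close>. For an involution \<open>a\<close> of \<open>E\<close>, the conjugate
  \<open>f = g a g\<^sup>-\<^sup>1\<close> has \<open>Q\<close> as its only fixed point in \<open>U\<close>, and some \<open>b\<close> in \<open>E\<close> maps \<open>f P\<close> to \<open>Q\<close>, so
  that the involution \<open>b f b\<close> interchanges \<open>P\<close> and \<open>Q\<close>. As no nontrivial element fixes both
  points, \<open>b f b\<close> does not depend on \<open>a\<close>, and comparing fixed points neither does \<open>f\<close>.\<close>

lemma (in group) fixes_point_if_semiregular: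
  fixes act :: "'a \<Rightarrow> 'p \<Rightarrow> 'p"
  assumes H: "subgroup H G"
    and act_mult: "\<And>g h x. g \<in> H \<Longrightarrow> h \<in> H \<Longrightarrow> x \<in> U \<Longrightarrow> act (g \<otimes> h) x = act g (act h x)"
    and act_one: "\<And>x. x \<in> U \<Longrightarrow> act \<one> x = x"
    and act_closed: "\<And>g x. g \<in> H \<Longrightarrow> x \<in> U \<Longrightarrow> act g x \<in> U"
    and P: "P \<in> U"
    and semireg: "\<And>g x. g \<in> H \<Longrightarrow> act g P = P \<Longrightarrow> x \<in> U \<Longrightarrow> x \<noteq> P \<Longrightarrow> act g x = x \<Longrightarrow> g = \<one>"
    and E: "E \<subseteq> H" "\<And>a. a \<in> E \<Longrightarrow> a \<otimes> a = \<one>" "\<And>a. a \<in> E \<Longrightarrow> act a P = P"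
    and ab: "a \<in> E" "a' \<in> E" "a \<noteq> \<one>" "a' \<noteq> \<one>" "a \<noteq> a'"
    and chord: "\<And>g a. g \<in> H \<Longrightarrow> a \<in> E \<Longrightarrow> act g P \<noteq> P \<Longrightarrow> act (g \<otimes> a \<otimes> inv g) P \<noteq> P \<Longrightarrow>
      \<exists>b\<in>E. act b (act (g \<otimes> a \<otimes> inv g) P) = act g P"
    and g: "g \<in> H"
  shows "act g P = P"
proof (rule ccontr)
  assume moved: "act g P \<noteq> P"
  define Q where "Q = act g P"
  have Q: "Q \<in> U" "Q \<noteq> P" using moved act_closed g P by (auto simp: Q_def)
  have Hc: "x \<in> carrier G" if "x \<in> H" for x using H that subgroup.mem_carrier by metis
  have Hm: "x \<otimes> y \<in> H" if "x \<in> H" "y \<in> H" for x y using H that by (rule subgroup.m_closed)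
  have Hi: "inv x \<in> H" if "x \<in> H" for x using H that by (rule subgroup.m_inv_closed)
  have act_inv: "act (inv h) (act h x) = x" if "h \<in> H" "x \<in> U" for h x
    using that act_mult[OF Hi[OF that(1)] that(1,2)] act_one Hc by simp
  define f where "f a = g \<otimes> a \<otimes> inv g" for a
  have fH: "f a \<in> H" if "a \<in> E" for a
    using that E(1) g by (auto simp: f_def intro: Hm Hi)
  \<comment> \<open>Pulled back by \<open>g\<close>, a fixed point of \<open>f a\<close> becomes one
    of \<open>a\<close>, and by semiregularity that can only be \<open>P\<close>.\<close>
  have f_unique: "x = Q" if "a \<in> E" "a \<noteq> \<one>" "x \<in> U" "act (f a) x = x" for a x
  proof -
    define y where "y = act (inv g) x"
    have aH: "a \<in> H" using that E by auto
    have y: "y \<in> U" using that g by (simp add: y_def act_closed Hi)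
    have x: "x = act g y"
      using act_inv[OF Hi[OF g] that(3)] g Hc by (simp add: y_def)
    have "act g (act a y) = act g y"
      using that(4) unfolding f_def x
      by (simp add: act_mult act_closed act_inv Hm Hi g aH y)
    then have "act a y = y"
      using act_inv[OF g] y aH act_closed by metis
    then have "y = P" using semireg[OF aH E(3) y] that by metis
    then show ?thesis by (simp add: x Q_def)
  qed
  have fQ: "act (f a) Q = Q" if "a \<in> E" for a
  proof -
    have "a \<in> H" using that E by auto
    then show ?thesis
      using that by (simp add: f_def Q_def act_mult act_closed act_inv Hm Hi g P E(3))
  qed
  have ff: "f a \<otimes> f a = \<one>" if "a \<in> E" for a
  proof -
    have a: "a \<in> carrier G" "g \<in> carrier G" using that E Hc g by auto
    then have "f a \<otimes> f a = g \<otimes> (a \<otimes> ((inv g \<otimes> g) \<otimes> (a \<otimes> inv g)))"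
      by (simp only: f_def m_assoc m_closed inv_closed)
    also have "\<dots> = g \<otimes> ((a \<otimes> a) \<otimes> inv g)" using a by (simp add: m_assoc)
    finally show ?thesis using a E(2)[OF that] by simp
  qed
  have swap: "\<exists>b\<in>E. act (b \<otimes> f a \<otimes> b) P = Q \<and> act (b \<otimes> f a \<otimes> b) Q = P"
    if aE: "a \<in> E" "a \<noteq> \<one>" for a
  proof -
    have "act (f a) P \<noteq> P" using f_unique[OF aE P] Q by auto
    then obtain b where b: "b \<in> E" "act b (act (f a) P) = Q"
      using chord[OF g aE(1) moved] by (auto simp: f_def Q_def)
    have bH: "b \<in> H" using b E by auto
    have ffP: "act (f a) (act (f a) P) = P"
      using act_mult[OF fH[OF aE(1)] fH[OF aE(1)] P] ff[OF aE(1)] act_one[OF P] by simp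
    have fP: "act (f a) P \<in> U" using act_closed fH aE P by auto
    have "act b Q = act (f a) P"
      using act_mult[OF bH bH fP] b E(2) act_one[OF fP] by simp
    then show ?thesis
      using b bH fH[OF aE(1)] P Q ffP E(3)[OF b(1)]
      by (intro bexI[of _ b]) (simp_all add: act_mult Hm act_closed)
  qed
  obtain b where b: "b \<in> E" "act (b \<otimes> f a \<otimes> b) P = Q" "act (b \<otimes> f a \<otimes> b) Q = P"
    using swap ab by blast
  obtain b' where b': "b' \<in> E" "act (b' \<otimes> f a' \<otimes> b') P = Q" "act (b' \<otimes> f a' \<otimes> b') Q = P"
    using swap ab by blast
  have inH: "b \<in> H" "b' \<in> H" "f a \<in> H" "f a' \<in> H" using b b' ab E fH by auto
  note inG = inH[THEN Hc]
  define w where "w = b \<otimes> f a \<otimes> b"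
  define w' where "w' = b' \<otimes> f a' \<otimes> b'"
  have wH: "w \<in> H" "w' \<in> H" by (simp_all add: w_def w'_def Hm inH)
  have bb: "b \<otimes> b = \<one>" "b' \<otimes> b' = \<one>" using E b b' by auto
  have cancel: "x \<otimes> (x \<otimes> y) = y" if "x \<otimes> x = \<one>" "x \<in> carrier G" "y \<in> carrier G" for x y
    using that by (simp flip: m_assoc)
  have "w' \<otimes> w' = \<one>"
    using inG bb ff[OF ab(2)] by (simp add: w'_def m_assoc cancel)
  \<comment> \<open>Both factors interchange \<open>P\<close> and \<open>Q\<close>, so the product
    fixes both points and semiregularity makes it trivial.\<close>
  moreover have "w \<otimes> w' = \<one>"
    using semireg[of "w \<otimes> w'" Q] b b' wH Q P
    by (simp add: act_mult Hm w_def w'_def inH)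
  ultimately have "w = w'"
    using wH Hc by (metis inv_equality)
  \<comment> \<open>So \<open>b' \<otimes> b\<close> conjugates \<open>f a\<close> into
    \<open>f a'\<close> and carries the only fixed point of the one to that of the other. Both are
    \<open>Q\<close>, hence \<open>b' \<otimes> b\<close> fixes \<open>P\<close> and
    \<open>Q\<close> and is trivial.\<close>
  then have "(b' \<otimes> b) \<otimes> f a = f a' \<otimes> (b' \<otimes> b)"
    using inG bb by (metis (no_types, lifting) w_def w'_def m_assoc m_closed cancel r_one)
  then have "act (f a') (act (b' \<otimes> b) Q) = act (b' \<otimes> b) Q"
    by (metis Hm act_mult inH Q(1) fQ ab(1))
  then have "act (b' \<otimes> b) Q = Q"
    using f_unique[OF ab(2,4)] act_closed Hm inH Q(1) by metis
  moreover have "act (b' \<otimes> b) P = P"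
    using b b' inH P E(3) by (simp add: act_mult)
  ultimately have "b' \<otimes> b = \<one>"
    using semireg[OF Hm[OF inH(2,1)]] Q by blast
  with \<open>(b' \<otimes> b) \<otimes> f a = f a' \<otimes> (b' \<otimes> b)\<close> have "f a = f a'" using inG by simp
  then have "a = a'"
    using ab(1,2) E(1) g Hc by (simp add: f_def subset_iff)
  with ab show False by simp
qed

section \<open>Stabilisers\<close>

text \<open>An injective self-map of a finite set is onto; invariance of the unital thus reduces to
  an inclusion.\<close>

lemma Bij_image_eq_if_subset:
  assumes "g \<in> Bij S" "U \<subseteq> S" "finite U" "g ` U \<subseteq> U"
  shows "g ` U = U"
  using assms by (intro endo_inj_surj) (auto simp: Bij_def bij_betw_def intro: inj_on_subset)

lemma one_PGL: "\<one>\<^bsub>PGammaL\<^esub> \<in> carrier PGL"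
proof -
  have "invertible (mat 1 :: 'a ^ 3 ^ 3)" by (auto simp: invertible_def)
  then show ?thesis unfolding carrier_PGL PGammaL_simps(2) collineation_id[symmetric] by blast
qed

lemma subgroup_PGL: "subgroup (carrier PGL) (PGammaL :: (('a::field ^ 3) set \<Rightarrow> _) monoid)"
proof (rule group.subgroupI[OF group_PGammaL carrier_PGL_subset])
  show "carrier PGL \<noteq> ({} :: (('a ^ 3) set \<Rightarrow> _) set)" using one_PGL by blast
next
  fix g :: "('a ^ 3) set \<Rightarrow> ('a ^ 3) set" assume "g \<in> carrier PGL"
  then obtain A where A: "invertible A" "g = collineation id A" by (auto simp: carrier_PGL)
  obtain B where B: "invertible B"
    "compose proj_points (collineation (inv_into UNIV id) B) g = (\<lambda>P\<in>proj_points. P)"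
    using collineation_inverse[OF field_automorphism_id A(1)] unfolding A(2) by metis
  then have "compose proj_points (collineation id B) g = \<one>\<^bsub>PGammaL\<^esub>"
    by (simp add: PGammaL_simps)
  then have "inv\<^bsub>PGammaL\<^esub> g = collineation id B"
    using A B by (intro group.inv_equality[OF group_PGammaL])
      (auto simp: PGammaL_mult collineation_in_PGammaL field_automorphism_id)
  then show "inv\<^bsub>PGammaL\<^esub> g \<in> carrier PGL" using B by (auto simp: carrier_PGL)
next
  fix g h :: "('a ^ 3) set \<Rightarrow> ('a ^ 3) set" assume "g \<in> carrier PGL" "h \<in> carrier PGL"
  then obtain A B where "invertible A" "g = collineation id A" "invertible B" "h = collineation id B"
    by (auto simp: carrier_PGL)
  then show "g \<otimes>\<^bsub>PGammaL\<^esub> h \<in> carrier PGL"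
    by (auto simp: collineation_mult field_automorphism_id carrier_PGL
        intro!: invertible_mult map_matrix_invertible)
qed

lemma subgroup_set_stabiliser:
  fixes U :: "('a::field ^ 3) set set"
  assumes "U \<subseteq> proj_points"
  shows "subgroup (set_stabiliser PGammaL U) PGammaL"
proof (rule group.subgroupI[OF group_PGammaL])
  interpret group "PGammaL :: (('a ^ 3) set \<Rightarrow> _) monoid" by (rule group_PGammaL)
  have image_mult: "(g \<otimes>\<^bsub>PGammaL\<^esub> h) ` U = g ` h ` U"
    if "g \<in> carrier PGammaL" "h \<in> carrier PGammaL" for g h
    using that assms by (auto simp: PGammaL_apply_mult image_image subset_eq intro!: image_cong)
  have image_one: "\<one>\<^bsub>PGammaL\<^esub> ` U = U"
    using assms by (auto simp: PGammaL_simps subset_eq image_iff)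
  show "set_stabiliser PGammaL U \<subseteq> carrier PGammaL" by (auto simp: set_stabiliser_def)
  show "set_stabiliser PGammaL U \<noteq> {}"
    using image_one one_closed by (auto simp: set_stabiliser_def)
  show "inv\<^bsub>PGammaL\<^esub> g \<in> set_stabiliser PGammaL U" if "g \<in> set_stabiliser PGammaL U" for g
  proof -
    have g: "g \<in> carrier PGammaL" "g ` U = U" using that by (auto simp: set_stabiliser_def)
    then have "(inv\<^bsub>PGammaL\<^esub> g) ` U = (inv\<^bsub>PGammaL\<^esub> g) ` g ` U" by simp
    also have "\<dots> = U" using image_mult[OF inv_closed[OF g(1)] g(1)] g image_one by simp
    finally show ?thesis using g by (simp add: set_stabiliser_def)
  qed
  show "g \<otimes>\<^bsub>PGammaL\<^esub> h \<in> set_stabiliser PGammaL U"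
    if "g \<in> set_stabiliser PGammaL U" "h \<in> set_stabiliser PGammaL U" for g h
    using that by (auto simp: set_stabiliser_def image_mult)
qed

lemma set_stabiliser_PGL: "set_stabiliser PGL U = carrier PGL \<inter> set_stabiliser PGammaL U"
  using carrier_PGL_subset by (auto simp: set_stabiliser_def)

section \<open>Coordinates of the unital\<close>

lemma vector_3_eq_iff:
  "(vector [a, b, c] :: 'a::zero ^ 3) = vector [a', b', c'] \<longleftrightarrow> a = a' \<and> b = b' \<and> c = c'"
  by (simp add: vec_eq_iff forall_3)

lemma vector_3_eq_0_iff: "(vector [a, b, c] :: 'a::zero ^ 3) = 0 \<longleftrightarrow> a = 0 \<and> b = 0 \<and> c = 0"
  by (simp add: vec_eq_iff forall_3)

lemma scale_vector_3: "k *s vector [a, b, c] = (vector [k * a, k * b, k * c] :: 'a::semiring_1 ^ 3)"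
  by (simp add: vec_eq_iff forall_3)

lemma vector_3E:
  obtains a b c where "(x :: 'a::zero ^ 3) = vector [a, b, c]"
  using that[of "x $ 1" "x $ 2" "x $ 3"] by (simp add: vec_eq_iff forall_3)

lemma semilinear_map_vector_3:
  "semilinear_map \<tau> (vector [vector [a11, a12, a13], vector [a21, a22, a23], vector [a31, a32, a33]])
     (vector [x, y, z]) =
   vector [\<tau> x * a11 + \<tau> y * a21 + \<tau> z * a31, \<tau> x * a12 + \<tau> y * a22 + \<tau> z * a32,
     \<tau> x * a13 + \<tau> y * a23 + \<tau> z * a33]"
  by (simp add: semilinear_map_def vector_matrix_mult_def vec_eq_iff forall_3 sum_3 mult.commute)

lemma matrix_3E:
  obtains a11 a12 a13 a21 a22 a23 a31 a32 a33 where
    "(A :: 'a::zero ^ 3 ^ 3) =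
      vector [vector [a11, a12, a13], vector [a21, a22, a23], vector [a31, a32, a33]]"
  using that[of "A $ 1 $ 1" "A $ 1 $ 2" "A $ 1 $ 3" "A $ 2 $ 1" "A $ 2 $ 2" "A $ 2 $ 3"
      "A $ 3 $ 1" "A $ 3 $ 2" "A $ 3 $ 3"]
  by (simp add: vec_eq_iff forall_3)

context tits_setting
begin

definition aff :: "'a \<Rightarrow> 'a \<Rightarrow> ('a ^ 3) set" where
  "aff x z = proj_point (vector [1, x, z])"

definition pinf :: "('a ^ 3) set" where
  "pinf = proj_point (vector [0, 0, 1])"

abbreviation unital_set :: "('a ^ 3) set set" where
  "unital_set \<equiv> U_BT e \<epsilon>"

lemma aff_eq_iff: "aff x z = aff x' z' \<longleftrightarrow> x = x' \<and> z = z'"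
  by (auto simp: aff_def proj_point_eq_iff vector_3_eq_0_iff scale_vector_3 vector_3_eq_iff)

lemma aff_neq_pinf: "aff x z \<noteq> pinf" "pinf \<noteq> aff x z"
  by (auto simp: aff_def pinf_def proj_point_eq_iff vector_3_eq_0_iff scale_vector_3 vector_3_eq_iff)

lemma proj_point_eq_aff: "a \<noteq> 0 \<Longrightarrow> proj_point (vector [a, b, c]) = aff (b / a) (c / a)"
  by (auto simp: aff_def proj_point_eq_iff vector_3_eq_0_iff scale_vector_3 vector_3_eq_iff
      intro!: exI[of _ a])

lemma aff_in_points: "aff x z \<in> proj_points" and pinf_in_points: "pinf \<in> proj_points"
  by (simp_all add: aff_def pinf_def vector_3_eq_0_iff)

text \<open>Replaces the parametrisation by one equation, with \<open>re z\<close> free, that can be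
  tested on the image of a point.\<close>

lemma unital_set_eq:
  "unital_set = insert pinf {aff x z | x z. im z = tits_fun e (re x) (im x)}" (is "_ = ?R")
proof
  show "unital_set \<subseteq> ?R"
  proof
    fix P assume "P \<in> unital_set"
    then consider "P = pinf" | r s t where "r \<in> Fq q" "s \<in> Fq q" "t \<in> Fq q"
      "P = aff (s + t * \<epsilon>) (r + tits_fun e s t * \<epsilon>)"
      unfolding U_BT_def Let_def q_eq[symmetric] pinf_def aff_def by blast
    then show "P \<in> ?R"
    proof cases
      case (2 r s t)
      then have "im (r + tits_fun e s t * \<epsilon>) =
          tits_fun e (re (s + t * \<epsilon>)) (im (s + t * \<epsilon>))" by simp
      with 2(4) show ?thesis by blast
    qed simp
  qed
  show "?R \<subseteq> unital_set"
  proof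
    fix P assume "P \<in> ?R"
    then consider "P = pinf" | x z where "P = aff x z" "im z = tits_fun e (re x) (im x)" by auto
    then show "P \<in> unital_set"
    proof cases
      case (2 x z)
      have "P = proj_point (vector [1, re x + im x * \<epsilon>, re z + tits_fun e (re x) (im x) * \<epsilon>])"
        using re_im[of x] re_im[of z] 2 by (simp add: aff_def)
      then show ?thesis
        unfolding U_BT_def Let_def q_eq[symmetric] using re_Fq im_Fq by blast
    qed (simp add: U_BT_def pinf_def Let_def)
  qed
qed

lemma pinf_in_unital: "pinf \<in> unital_set"
  by (simp add: unital_set_eq)

lemma aff_in_unital_iff: "aff x z \<in> unital_set \<longleftrightarrow> im z = tits_fun e (re x) (im x)"
  by (auto simp: unital_set_eq aff_eq_iff aff_neq_pinf)

lemma unital_cases: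
  assumes "P \<in> unital_set"
  obtains "P = pinf" | x z where "P = aff x z" "im z = tits_fun e (re x) (im x)"
  using assms by (auto simp: unital_set_eq)

lemma unital_subset_points: "unital_set \<subseteq> proj_points"
  by (auto simp: unital_set_eq aff_in_points pinf_in_points)

text \<open>Together with \<open>pinf\<close> these points form the line at infinity, which is
  therefore tangent to the unital at \<open>pinf\<close>.\<close>

lemma infinite_line_not_in_unital: "proj_point (vector [0, 1, m]) \<notin> unital_set"
  by (auto simp: unital_set_eq aff_def pinf_def proj_point_eq_iff vector_3_eq_0_iff scale_vector_3
      vector_3_eq_iff)

section \<open>The translations\<close>

text \<open>The matrix \<open>M\<^sub>u\<^sub>v\<close>. Here \<open>u\<close> and \<open>v\<close>
  are arbitrary field elements; membership in \<open>Fq q\<close> is imposed where the unital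
  enters.\<close>

definition trans_matrix :: "'a \<Rightarrow> 'a \<Rightarrow> 'a ^ 3 ^ 3" where
  "trans_matrix u v = vector [vector [1, u * \<epsilon>, v + sigma u * \<epsilon>],
     vector [0, 1, u + u * \<epsilon>], vector [0, 0, 1]]"

definition trans :: "'a \<Rightarrow> 'a \<Rightarrow> ('a ^ 3) set \<Rightarrow> ('a ^ 3) set" where
  "trans u v = collineation id (trans_matrix u v)"

lemma eps_nonzero: "\<epsilon> \<noteq> 0"
  using conj_eps conj_simps(3) by (metis add_0 zero_neq_one)

lemma eps_mult_eps_left: "\<epsilon> * (\<epsilon> * x) = \<epsilon> * x + \<delta> * x"
  by (simp add: eps_mult_eps distrib_right flip: mult.assoc)

text \<open>The term \<open>u * u' * \<delta>\<close> arises from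
  \<open>\<epsilon> + \<epsilon> * \<epsilon> = \<delta>\<close>. Because of it, an element with
  \<open>u \<noteq> 0\<close> has a nontrivial square.\<close>

lemma trans_matrix_mult:
  "trans_matrix u' v' ** trans_matrix u v = trans_matrix (u + u') (v + v' + u * u' * \<delta>)"
  by (simp add: trans_matrix_def matrix_matrix_mult_def vec_eq_iff forall_3 sum_3)
    (simp add: algebra_simps eps_mult_eps_left)

lemma trans_matrix_0: "trans_matrix 0 0 = mat 1"
  by (simp add: trans_matrix_def mat_def vec_eq_iff forall_3)

lemma invertible_trans_matrix: "invertible (trans_matrix u v)"
proof -
  \<comment> \<open>The extra \<open>u * u * \<delta>\<close> cancels the one that the product
    formula contributes.\<close>
  have "trans_matrix u v ** trans_matrix u (v + u * u * \<delta>) = mat 1"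
    "trans_matrix u (v + u * u * \<delta>) ** trans_matrix u v = mat 1"
    unfolding trans_matrix_mult by (simp_all add: trans_matrix_0[symmetric] add_ac)
  then show ?thesis unfolding invertible_def by blast
qed

lemma trans_in_PGL: "trans u v \<in> carrier PGL"
  by (auto simp: trans_def carrier_PGL invertible_trans_matrix)

lemma trans_in_PGammaL: "trans u v \<in> carrier PGammaL"
  using trans_in_PGL carrier_PGL_subset by blast

lemma trans_mult: "trans u v \<otimes>\<^bsub>PGammaL\<^esub> trans u' v' = trans (u + u') (v + v' + u * u' * \<delta>)"
proof -
  have "map_matrix id A = A" for A :: "'a ^ 3 ^ 3" by (simp add: map_matrix_def)
  then show ?thesis
    by (simp add: trans_def collineation_mult field_automorphism_id invertible_trans_matrix
        trans_matrix_mult)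
qed

lemma trans_0: "trans 0 0 = \<one>\<^bsub>PGammaL\<^esub>"
  by (simp add: trans_def trans_matrix_0 PGammaL_simps collineation_id)

lemma trans_aff: "trans u v (aff x z) = aff (x + u * \<epsilon>) (z + (u + u * \<epsilon>) * x + (v + sigma u * \<epsilon>))"
  by (simp add: trans_def trans_matrix_def aff_def collineation_proj_point field_automorphism_id
      vector_3_eq_0_iff semilinear_map_vector_3 add_ac mult_ac)

lemma trans_pinf: "trans u v pinf = pinf"
  by (simp add: trans_def trans_matrix_def pinf_def collineation_proj_point field_automorphism_id
      vector_3_eq_0_iff semilinear_map_vector_3)

lemma trans_fixes_aff: "trans u v (aff x z) = aff x z \<Longrightarrow> u = 0 \<and> v = 0"
  using eps_nonzero by (auto simp: trans_aff aff_eq_iff)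

lemma trans_eq_iff: "trans u v = trans u' v' \<longleftrightarrow> u = u' \<and> v = v'"
proof
  assume "trans u v = trans u' v'"
  then have "trans u v (aff 0 0) = trans u' v' (aff 0 0)" by simp
  then show "u = u' \<and> v = v'" using eps_nonzero by (auto simp: trans_aff aff_eq_iff)
qed auto

text \<open>Rests on \<open>tits_fun e s (t + u) = tits_fun e s t + u * s + sigma u\<close>, whose
  added terms are what the last column of the matrix contributes to \<open>im z\<close>.\<close>

lemma trans_stabilises:
  assumes "u \<in> Fq q" "v \<in> Fq q"
  shows "trans u v ` unital_set = unital_set"
proof (rule Bij_image_eq_if_subset[OF _ unital_subset_points finite])
  show "trans u v \<in> Bij proj_points" using trans_in_PGammaL carrier_PGammaL_Bij by blast
  show "trans u v ` unital_set \<subseteq> unital_set"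
  proof clarify
    fix P assume "P \<in> unital_set"
    then show "trans u v P \<in> unital_set"
    proof (cases rule: unital_cases)
      case (2 x z)
      obtain s t where x: "s \<in> Fq q" "t \<in> Fq q" "x = s + t * \<epsilon>" by (rule coordsE)
      have 1: "x + u * \<epsilon> = s + (t + u) * \<epsilon>" by (simp add: x algebra_simps)
      have 3: "(u + u * \<epsilon>) * x + (v + sigma u * \<epsilon>) = (u * s + u * t * \<delta> + v) + (u * s + sigma u) * \<epsilon>"
        unfolding x coords_mult by (simp add: algebra_simps)
      have 4: "im z = tits_fun e s t" using 2 x by simp
      have "im (z + (u + u * \<epsilon>) * x + (v + sigma u * \<epsilon>)) = tits_fun e s t + (u * s + sigma u)"
        unfolding add.assoc[of z] 3 im_add[of z] 4 using x(1,2) assms by simp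
      also have "\<dots> = tits_fun e s (t + u)" by (simp add: tits_fun_eq algebra_simps)
      finally show ?thesis
        unfolding 2 trans_aff aff_in_unital_iff 1 using x(1,2) assms by simp
    qed (simp add: trans_pinf pinf_in_unital)
  qed
qed

text \<open>\<open>\<ell>\<^sub>\<infinity>\<close> is invariant because every other line through \<open>pinf\<close> contains an affine point of the
  unital; hence the matrix is triangular.\<close>

lemma stabiliser_fixing_pinf:
  assumes g: "g \<in> set_stabiliser PGL unital_set" and fix_pinf: "g pinf = pinf"
  obtains u v where "u \<in> Fq q" "v \<in> Fq q" "g = trans u v"
proof -
  obtain A where A: "invertible A" "g = collineation id A" and gU: "g ` unital_set = unital_set"
    using g by (auto simp: set_stabiliser_def carrier_PGL)
  obtain a11 a12 a13 a21 a22 a23 a31 a32 a33 where A_eq: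
    "A = vector [vector [a11, a12, a13], vector [a21, a22, a23], vector [a31, a32, a33]]"
    by (rule matrix_3E)
  have map: "semilinear_map id A (vector [x, y, z]) = vector [x * a11 + y * a21 + z * a31,
      x * a12 + y * a22 + z * a32, x * a13 + y * a23 + z * a33]" for x y z
    by (simp add: A_eq semilinear_map_vector_3)
  note g_point = collineation_proj_point[OF field_automorphism_id, of _ A, folded A(2)]
  have nz: "semilinear_map id A (vector [x, y, z]) = 0 \<longleftrightarrow> x = 0 \<and> y = 0 \<and> z = 0" for x y z
    by (simp add: semilinear_map_eq_0_iff field_automorphism_id A vector_3_eq_0_iff)
  have "proj_point (vector [a31, a32, a33]) = proj_point (vector [0, 0, 1])"
    using fix_pinf by (simp add: pinf_def g_point vector_3_eq_0_iff map)
  moreover have "vector [a31, a32, a33] \<noteq> (0 :: 'a ^ 3)"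
    using nz[of 0 0 1] by (simp add: map)
  ultimately have a3: "a31 = 0" "a32 = 0" "a33 \<noteq> 0"
    by (auto simp: proj_point_eq_iff scale_vector_3 vector_3_eq_iff)
  have inj: "inj_on g proj_points"
    using collineation_Bij[OF field_automorphism_id A(1)] A(2) by (auto simp: Bij_def bij_betw_def)
  have a21: "a21 = 0"
  proof (rule ccontr)
    assume nz21: "a21 \<noteq> 0"
    \<comment> \<open>The point \<open>(0, 1, m)\<close> is sent to
      \<open>(a21, a22, a23 + m * a33)\<close>. The value of \<open>m\<close> is solved for so that
      this is an affine point of the unital.\<close>
    define z where "z = tits_fun e (re (a22 / a21)) (im (a22 / a21)) * \<epsilon>"
    define m where "m = (z * a21 - a23) / a33"
    have "im z = tits_fun e (re (a22 / a21)) (im (a22 / a21))"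
      using im_coords[of 0 "tits_fun e (re (a22 / a21)) (im (a22 / a21))"] by (simp add: z_def)
    then have "aff (a22 / a21) z \<in> unital_set" by (simp add: aff_in_unital_iff)
    moreover have "g (proj_point (vector [0, 1, m])) = aff (a22 / a21) z"
      using a3 nz21 by (simp add: g_point vector_3_eq_0_iff map proj_point_eq_aff m_def)
    ultimately have "g (proj_point (vector [0, 1, m])) \<in> g ` unital_set" by (simp add: gU)
    then have "proj_point (vector [0, 1, m]) \<in> unital_set"
      using inj unital_subset_points by (simp add: inj_on_image_mem_iff vector_3_eq_0_iff)
    then show False by (simp add: infinite_line_not_in_unital)
  qed
  have a22: "a22 \<noteq> 0"
  proof
    assume "a22 = 0"
    then have "semilinear_map id A (vector [0, a33, - a23]) = 0"
      by (simp add: map a21 a3 vector_3_eq_0_iff mult.commute)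
    then show False using nz a3 by blast
  qed
  have a11: "a11 \<noteq> 0"
  proof
    assume "a11 = 0"
    \<comment> \<open>A nonzero kernel vector of the triangular matrix, found by back
      substitution.\<close>
    then have "semilinear_map id A (vector [a22 * a33, - (a12 * a33), a12 * a23 - a13 * a22]) = 0"
      by (simp add: map a21 a3 vector_3_eq_0_iff algebra_simps)
    then show False using nz a3 a22 by (metis mult_eq_0_iff)
  qed
  have g_aff: "g (aff x z) = aff (a22 / a11 * x + a12 / a11) (a33 / a11 * z + a23 / a11 * x + a13 / a11)"
    for x z
  proof -
    have "g (aff x z) = proj_point (vector [a11, a12 + x * a22, a13 + x * a23 + z * a33])"
      by (simp add: aff_def g_point vector_3_eq_0_iff map a21 a3)
    also have "\<dots> = aff ((a12 + x * a22) / a11) ((a13 + x * a23 + z * a33) / a11)"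
      using a11 by (rule proj_point_eq_aff)
    finally show ?thesis by (simp add: add_divide_distrib mult.commute add_ac)
  qed
  obtain u v where uv: "u \<in> Fq q" "v \<in> Fq q" "a22 / a11 = 1" "a33 / a11 = 1" "a12 / a11 = u * \<epsilon>"
    "a23 / a11 = u + u * \<epsilon>" "a13 / a11 = v + sigma u * \<epsilon>"
  proof (rule affine_symmetries[of "a22 / a11" "a33 / a11" "a23 / a11" "a13 / a11" "a12 / a11"])
    show "a22 / a11 \<noteq> 0" using a22 a11 by simp
    fix x z assume "im z = tits_fun e (re x) (im x)"
    then have "aff x z \<in> unital_set" by (simp add: aff_in_unital_iff)
    then have "g (aff x z) \<in> unital_set" using gU by blast
    then show "im (a33 / a11 * z + a23 / a11 * x + a13 / a11) =
        tits_fun e (re (a22 / a11 * x + a12 / a11)) (im (a22 / a11 * x + a12 / a11))"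
      by (simp only: g_aff aff_in_unital_iff)
  qed (rule that)
  then have entries: "a22 = a11" "a33 = a11" "a12 = a11 * (u * \<epsilon>)" "a23 = a11 * (u + u * \<epsilon>)"
    "a13 = a11 * (v + sigma u * \<epsilon>)"
    using a11 by (simp_all add: divide_eq_eq mult.commute)
  have "g = trans u v"
    unfolding trans_def
  proof (rule collineation_eqI)
    show "g \<in> extensional proj_points" by (simp add: A collineation_def)
    fix x :: "'a ^ 3" assume x: "x \<noteq> 0"
    obtain x1 x2 x3 where x_eq: "x = vector [x1, x2, x3]" by (rule vector_3E)
    have "semilinear_map id A x = a11 *s semilinear_map id (trans_matrix u v) x"
      unfolding x_eq map trans_matrix_def semilinear_map_vector_3 scale_vector_3
      unfolding a21 a3 entries by (simp add: vector_3_eq_iff algebra_simps)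
    then show "g (proj_point x) = proj_point (semilinear_map id (trans_matrix u v) x)"
      using g_point[OF x] a11 by (simp add: proj_point_scale)
  qed (rule field_automorphism_id)
  with uv show thesis using that by blast
qed

section \<open>The projectivities stabilising the unital\<close>

lemma card_Fq_ge: "card (Fq q :: 'a set) \<ge> 3"
  using sigma_bounds card_Fq by simp

text \<open>The involutions for \<open>fixes_point_if_semiregular\<close> are the elations
  \<open>trans 0 v\<close> with centre \<open>pinf\<close>. A conjugate by \<open>h\<close> has
  centre \<open>h pinf\<close>, so it moves \<open>pinf\<close> along the line joining the two
  points; the elations are transitive on the affine points of the unital on that line.\<close>

lemma stabiliser_fixes_pinf:
  assumes g: "g \<in> set_stabiliser PGL unital_set"
  shows "g pinf = pinf"
proof -
  interpret group "PGammaL :: (('a ^ 3) set \<Rightarrow> _) monoid" by (rule group_PGammaL)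
  let ?H = "set_stabiliser PGL unital_set"
  have H: "subgroup ?H PGammaL"
    unfolding set_stabiliser_PGL
    by (intro subgroups_Inter_pair subgroup_PGL subgroup_set_stabiliser unital_subset_points)
  have HG: "?H \<subseteq> carrier PGammaL" using H subgroup.subset by blast
  define E where "E = trans 0 ` Fq q"
  have EH: "E \<subseteq> ?H"
    by (auto simp: E_def set_stabiliser_def trans_in_PGL intro!: trans_stabilises)
  \<comment> \<open>A third element of \<open>Fq q\<close> supplies the second of two distinct
    nontrivial elations.\<close>
  have "\<not> Fq q \<subseteq> {0, 1 :: 'a}"
    using card_Fq_ge card_mono[of "{0, 1 :: 'a}" "Fq q"] by auto
  then obtain v :: 'a where v: "v \<in> Fq q" "v \<noteq> 0" "v \<noteq> 1" by auto
  show ?thesis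
  proof (rule fixes_point_if_semiregular[where act = "\<lambda>h. h" and H = ?H and U = unital_set and E = E
        and a = "trans 0 1" and a' = "trans 0 v"])
    show "(g \<otimes>\<^bsub>PGammaL\<^esub> h) x = g (h x)" if "g \<in> ?H" "h \<in> ?H" "x \<in> unital_set" for g h x
      using that HG unital_subset_points by (intro PGammaL_apply_mult) auto
    show "\<one>\<^bsub>PGammaL\<^esub> x = x" if "x \<in> unital_set" for x
      using that unital_subset_points by (auto simp: PGammaL_simps)
    show "g x \<in> unital_set" if "g \<in> ?H" "x \<in> unital_set" for g x
      using that by (auto simp: set_stabiliser_def)
    show "h = \<one>\<^bsub>PGammaL\<^esub>"
      if h: "h \<in> ?H" "h pinf = pinf" "x \<in> unital_set" "x \<noteq> pinf" "h x = x" for h x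
    proof -
      obtain u v where "h = trans u v" using stabiliser_fixing_pinf[OF h(1,2)] by metis
      moreover obtain y z where "x = aff y z" using h(3,4) unital_cases[of x] by metis
      ultimately show ?thesis using h(5) trans_fixes_aff trans_0 by blast
    qed
    show "h \<otimes>\<^bsub>PGammaL\<^esub> h = \<one>\<^bsub>PGammaL\<^esub>" if "h \<in> E" for h
      using that by (auto simp: E_def trans_mult trans_0)
    show "h pinf = pinf" if "h \<in> E" for h
      using that by (auto simp: E_def trans_pinf)
    show "trans 0 1 \<noteq> \<one>\<^bsub>PGammaL\<^esub>" "trans 0 v \<noteq> \<one>\<^bsub>PGammaL\<^esub>" "trans 0 1 \<noteq> trans 0 v"
      using v by (auto simp: trans_eq_iff simp flip: trans_0)
    show "\<exists>b\<in>E. b ((h \<otimes>\<^bsub>PGammaL\<^esub> a \<otimes>\<^bsub>PGammaL\<^esub> inv\<^bsub>PGammaL\<^esub> h) pinf) = h pinf"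
      if h: "h \<in> ?H" "a \<in> E" "h pinf \<noteq> pinf"
        "(h \<otimes>\<^bsub>PGammaL\<^esub> a \<otimes>\<^bsub>PGammaL\<^esub> inv\<^bsub>PGammaL\<^esub> h) pinf \<noteq> pinf" for h a
    proof -
      let ?f = "h \<otimes>\<^bsub>PGammaL\<^esub> a \<otimes>\<^bsub>PGammaL\<^esub> inv\<^bsub>PGammaL\<^esub> h"
      obtain k where k: "a = trans 0 k" using h(2) by (auto simp: E_def)
      have hG: "h \<in> carrier PGammaL" "a \<in> carrier PGammaL" using h HG EH by auto
      obtain A where A: "invertible A" "h = collineation id A"
        using h(1) by (auto simp: set_stabiliser_def carrier_PGL)
      note h_point = collineation_proj_point[OF field_automorphism_id, of _ A, folded A(2)]
      let ?m = "semilinear_map id A"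
      let ?e3 = "vector [0, 0, 1] :: 'a ^ 3"
      have e3: "?e3 \<noteq> 0" by (simp add: vector_3_eq_0_iff)
      have hinv_Bij: "inv\<^bsub>PGammaL\<^esub> h \<in> Bij proj_points"
        using hG carrier_PGammaL_Bij by blast
      then have "(inv\<^bsub>PGammaL\<^esub> h) pinf \<in> proj_points"
        using pinf_in_points by (auto simp: Bij_def bij_betw_def)
      then obtain y where y: "y \<noteq> 0" "(inv\<^bsub>PGammaL\<^esub> h) pinf = proj_point y"
        by (rule proj_pointsE)
      obtain y1 y2 y3 where y_eq: "y = vector [y1, y2, y3]" by (rule vector_3E)
      have "h (proj_point y) = pinf"
        using PGammaL_apply_mult[OF hG(1) inv_closed[OF hG(1)] pinf_in_points] hG pinf_in_points
        by (simp add: y(2)[symmetric] PGammaL_simps)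
      then have "proj_point (?m y) = proj_point ?e3"
        using y by (simp add: h_point pinf_def)
      then obtain c where c: "c \<noteq> 0" "?m y = c *s ?e3"
        using y A by (auto simp: proj_point_eq_iff semilinear_map_eq_0_iff field_automorphism_id)
      \<comment> \<open>The elation adds to \<open>y\<close> a multiple of the vector representing
        \<open>pinf\<close>. Applying \<open>h\<close> shows that \<open>?f pinf\<close> lies on the
        line through \<open>pinf\<close> and \<open>h pinf\<close>.\<close>
      have y': "vector [y1, y2, y1 * k + y3] = y + (k * y1) *s ?e3"
        by (simp add: y_eq vec_eq_iff forall_3 add_ac mult.commute)
      have "?f pinf = h (a (proj_point y))"
        using hG pinf_in_points y by (simp add: PGammaL_apply_mult)
      also have "a (proj_point y) = proj_point (y + (k * y1) *s ?e3)"
        using y(1) unfolding y'[symmetric]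
        by (simp add: k y_eq trans_def trans_matrix_def collineation_proj_point field_automorphism_id
            semilinear_map_vector_3)
      also have "h (proj_point (y + (k * y1) *s ?e3)) = proj_point (?m (y + (k * y1) *s ?e3))"
        using y(1) unfolding y'[symmetric]
        by (intro h_point) (auto simp: y_eq vector_3_eq_0_iff)
      also have "?m (y + (k * y1) *s ?e3) = c *s ?e3 + (k * y1) *s ?m ?e3"
        by (simp add: semilinear_map_add semilinear_map_scale field_automorphism_id c)
      finally have fP: "?f pinf = proj_point (c *s ?e3 + (k * y1) *s ?m ?e3)" .
      have "h pinf \<in> unital_set" using h(1) pinf_in_unital by (auto simp: set_stabiliser_def)
      then obtain x z where xz: "h pinf = aff x z" "im z = tits_fun e (re x) (im x)"
        using h(3) unital_cases[of "h pinf"] by metis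
      have "proj_point (?m ?e3) = proj_point (vector [1, x, z])"
        using xz(1) unfolding pinf_def aff_def h_point[OF e3] .
      moreover have "?m ?e3 \<noteq> 0"
        using e3 A(1) by (simp add: semilinear_map_eq_0_iff field_automorphism_id)
      ultimately obtain l where l: "l \<noteq> 0" "?m ?e3 = l *s vector [1, x, z]"
        using proj_point_eq_iff by metis
      define d where "d = k * y1 * l"
      have fP': "?f pinf = proj_point (vector [d, d * x, c + d * z])"
        unfolding fP l(2) by (rule arg_cong[of _ _ proj_point])
          (simp add: d_def vec_eq_iff forall_3 mult.assoc)
      have "d \<noteq> 0"
      proof
        assume "d = 0"
        then have "?f pinf = proj_point (c *s ?e3)" by (simp add: fP' scale_vector_3)
        then have "?f pinf = pinf" unfolding proj_point_scale[OF c(1)] pinf_def .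
        with h(4) show False by simp
      qed
      then have fP'': "?f pinf = aff x (z + c / d)"
        by (simp add: fP' proj_point_eq_aff) (simp add: field_simps)
      have "?f \<in> ?H" using h EH H by (meson subgroup.m_closed subgroup.m_inv_closed subsetD)
      then have "aff x (z + c / d) \<in> unital_set"
        using pinf_in_unital by (auto simp: set_stabiliser_def fP''[symmetric])
      \<comment> \<open>Both points lie on the unital and have the same first affine coordinate, so
        their second coordinates differ by an element of \<open>Fq q\<close>.\<close>
      then have "c / d \<in> Fq q"
        using xz(2) by (simp add: aff_in_unital_iff im_add im_eq_0_iff[symmetric])
      then have "trans 0 (c / d) \<in> E" by (auto simp: E_def)
      moreover have "trans 0 (c / d) (?f pinf) = h pinf"
        unfolding fP'' xz(1) by (simp add: trans_aff aff_eq_iff add_ac)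
      ultimately show ?thesis by blast
    qed
  qed (use H EH g v pinf_in_unital in \<open>auto simp: E_def\<close>)
qed

lemma stabiliser_PGL: "set_stabiliser PGL unital_set = (\<lambda>(u, v). trans u v) ` (Fq q \<times> Fq q)"
proof
  show "set_stabiliser PGL unital_set \<subseteq> (\<lambda>(u, v). trans u v) ` (Fq q \<times> Fq q)"
  proof
    fix g :: "('a ^ 3) set \<Rightarrow> ('a ^ 3) set" assume "g \<in> set_stabiliser PGL unital_set"
    then obtain u v where "u \<in> Fq q" "v \<in> Fq q" "g = trans u v"
      using stabiliser_fixing_pinf stabiliser_fixes_pinf by metis
    then show "g \<in> (\<lambda>(u, v). trans u v) ` (Fq q \<times> Fq q)" by blast
  qed
  show "(\<lambda>(u, v). trans u v) ` (Fq q \<times> Fq q) \<subseteq> set_stabiliser PGL unital_set"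
    by (auto simp: set_stabiliser_def trans_in_PGL intro!: trans_stabilises)
qed

lemma card_stabiliser_PGL: "card (set_stabiliser PGL unital_set) = q ^ 2"
proof -
  have "inj_on (\<lambda>(u, v). trans u v) (Fq q \<times> Fq q)"
    by (auto simp: inj_on_def trans_eq_iff)
  then show ?thesis
    unfolding stabiliser_PGL by (simp add: card_image card_cartesian_product card_Fq power2_eq_square)
qed

section \<open>The collineation of order \<open>16 e + 8\<close>\<close>

abbreviation (input) "\<psi> \<equiv> psi e \<epsilon> \<delta>"

text \<open>The preimage of \<delta> under \<open>sigma\<close>, since the two exponents multiply to
  \<open>q\<close>; it is also a square root of \<open>sigma \<delta>\<close>. These two facts make
  \<psi> preserve the unital.\<close>

definition delta_root :: 'a where
  "delta_root = \<delta> ^ 2 ^ e"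

definition psi_coeff :: 'a where
  "psi_coeff = delta_root * (1 + \<epsilon>)"

lemma delta_root_Fq: "delta_root \<in> Fq q"
  by (simp add: delta_root_def)

lemma delta_root_square: "delta_root * delta_root = sigma \<delta>"
  by (simp add: delta_root_def sigma_def mult_2 flip: power_add)

lemma sigma_delta_root: "sigma delta_root = \<delta>"
proof -
  have "q = 2 ^ (e + (e + 1))" by (simp add: q_eq mult_2)
  then have "q = 2 ^ e * 2 ^ (e + 1)" by (simp only: power_add)
  then have "sigma delta_root = \<delta> ^ q"
    by (simp only: delta_root_def sigma_def power_mult)
  then show ?thesis using delta_Fq by (simp add: Fq_def)
qed

lemma psi_coeff_nonzero: "psi_coeff \<noteq> 0"
proof -
  have "1 + \<epsilon> \<noteq> 0"
    using conj_eps eps_nonzero by (metis add.commute conj_simps(3) conj_conj)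
  then show ?thesis using delta_nonzero by (simp add: psi_coeff_def delta_root_def)
qed

lemma psi_coeff_coords: "psi_coeff = delta_root + delta_root * \<epsilon>"
  by (simp add: psi_coeff_def distrib_left)

definition psi_matrix :: "'a ^ 3 ^ 3" where
  "psi_matrix = vector [vector [1, 1, \<epsilon>], vector [0, psi_coeff, psi_coeff],
     vector [0, 0, sigma \<delta> * \<delta>]]"

text \<open>The exponent is written \<open>2 ^ 1\<close> so that the results on the maps
  \<open>x ^ 2 ^ k\<close> apply.\<close>

lemma psi_eq: "\<psi> = collineation (\<lambda>x. x ^ 2 ^ 1) psi_matrix"
  by (simp add: psi_def psi_matrix_def psi_coeff_def delta_root_def sigma_def mult.commute)

lemma invertible_psi_matrix: "invertible psi_matrix"
proof -
  have "det psi_matrix \<noteq> 0"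
    using psi_coeff_nonzero delta_nonzero by (simp add: det_3 psi_matrix_def)
  then show ?thesis by (simp add: invertible_det_nz)
qed

lemmas frobenius_automorphism = field_automorphism_frobenius[OF char_two]

lemma psi_in_PGammaL: "\<psi> \<in> carrier PGammaL"
  unfolding psi_eq by (rule collineation_in_PGammaL[OF frobenius_automorphism invertible_psi_matrix])

lemma psi_aff:
  "\<psi> (aff x z) = aff (1 + x\<^sup>2 * psi_coeff) (\<epsilon> + x\<^sup>2 * psi_coeff + z\<^sup>2 * (sigma \<delta> * \<delta>))"
  unfolding psi_eq aff_def
  by (subst collineation_proj_point[OF frobenius_automorphism])
     (simp_all add: vector_3_eq_0_iff psi_matrix_def semilinear_map_vector_3)

lemma psi_pinf: "\<psi> pinf = pinf"
proof -
  have "\<psi> pinf = proj_point ((sigma \<delta> * \<delta>) *s vector [0, 0, 1])"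
    unfolding psi_eq pinf_def
    by (subst collineation_proj_point[OF frobenius_automorphism])
       (simp_all add: vector_3_eq_0_iff psi_matrix_def semilinear_map_vector_3 scale_vector_3)
  also have "\<dots> = pinf"
    unfolding pinf_def using delta_nonzero by (intro proj_point_scale) simp
  finally show ?thesis .
qed

lemma psi_stabilises: "\<psi> ` unital_set = unital_set"
proof (rule Bij_image_eq_if_subset[OF _ unital_subset_points finite])
  show "\<psi> \<in> Bij proj_points" using psi_in_PGammaL carrier_PGammaL_Bij by blast
  show "\<psi> ` unital_set \<subseteq> unital_set"
  proof clarify
    fix P assume "P \<in> unital_set"
    then show "\<psi> P \<in> unital_set"
    proof (cases rule: unital_cases)
      case (2 x z)
      obtain s t where x: "s \<in> Fq q" "t \<in> Fq q" "x = s + t * \<epsilon>" by (rule coordsE)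
      obtain r f where z: "r \<in> Fq q" "f \<in> Fq q" "z = r + f * \<epsilon>" by (rule coordsE)
      have f: "f = tits_fun e s t" using 2 x z by simp
      define a where "a = delta_root * s\<^sup>2"
      define b where "b = delta_root * (s\<^sup>2 + t\<^sup>2 * \<delta>)"
      define N where "N = sigma \<delta> * \<delta>"
      have in_Fq: "a \<in> Fq q" "b \<in> Fq q" "N \<in> Fq q"
        by (simp_all add: a_def b_def N_def delta_root_Fq x(1,2))
      have square: "(k + l * \<epsilon>)\<^sup>2 = (k\<^sup>2 + l\<^sup>2 * \<delta>) + l\<^sup>2 * \<epsilon>" for k l
        by (simp add: square_add power_mult_distrib eps_square algebra_simps)
      have xd: "x\<^sup>2 * psi_coeff = a + b * \<epsilon>"
        unfolding x square psi_coeff_coords coords_mult a_def b_def by (simp add: algebra_simps)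
      have 1: "1 + x\<^sup>2 * psi_coeff = (1 + a) + b * \<epsilon>" by (simp add: xd add.assoc)
      have 3: "\<epsilon> + x\<^sup>2 * psi_coeff + z\<^sup>2 * N = (a + N * (r\<^sup>2 + f\<^sup>2 * \<delta>)) + (1 + b + N * f\<^sup>2) * \<epsilon>"
        unfolding xd z square by (simp add: algebra_simps)
      have root: "delta_root * (delta_root * y) = sigma \<delta> * y" for y
        by (simp add: delta_root_square flip: mult.assoc)
      \<comment> \<open>After expansion the terms besides \<open>1 + b\<close> cancel in pairs or
        carry the factor \<open>N\<close>, by the two properties of
        \<open>delta_root\<close>.\<close>
      have "1 + b + N * f\<^sup>2 = tits_fun e (1 + a) b"
        by (simp add: f tits_fun_eq a_def b_def N_def square_add power_mult_distrib sigma_delta_root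
            power2_eq_square algebra_simps root delta_root_square)
      then show ?thesis
        unfolding 2 psi_aff aff_in_unital_iff N_def[symmetric] 1 3
        using in_Fq x(1,2) z(1,2) by simp
    qed (simp add: psi_pinf pinf_in_unital)
  qed
qed

section \<open>The trace of \<open>psi_coeff\<close> and the powers of \<psi>\<close>

definition partial_trace :: "nat \<Rightarrow> 'a" where
  "partial_trace k = (\<Sum>i<k. psi_coeff ^ 2 ^ i)"

text \<open>Squaring shifts the summands by one. The partial traces thus form the orbit of 0 under y
  -> y^2 + \<open>psi_coeff\<close>.\<close>

lemma partial_trace_Suc: "partial_trace (Suc k) = psi_coeff + (partial_trace k)\<^sup>2"
proof (induction k)
  case (Suc k)
  have "partial_trace (Suc (Suc k)) = partial_trace (Suc k) + psi_coeff ^ 2 ^ Suc k"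
    by (simp add: partial_trace_def)
  also have "\<dots> = psi_coeff + ((partial_trace k)\<^sup>2 + (psi_coeff ^ 2 ^ k)\<^sup>2)"
    unfolding Suc by (simp add: add.assoc flip: power_mult) (simp add: mult.commute)
  also have "\<dots> = psi_coeff + (partial_trace (Suc k))\<^sup>2"
    by (simp add: partial_trace_def square_add)
  finally show ?case .
qed (simp add: partial_trace_def)

text \<open>Transitivity of the trace: pairing the summands \<open>i\<close> and
  \<open>2 * e + 1 + i\<close> replaces \<open>psi_coeff\<close> by its relative trace
  \<open>delta_root\<close>. This is a Frobenius image of \<delta>, so its absolute trace is the
  image of 1.\<close>

lemma partial_trace_full: "partial_trace (4 * e + 2) = 1"
proof -
  let ?m = "2 * e + 1"
  have split: "(\<Sum>i<?m + k. f i) = (\<Sum>i<?m. f i) + (\<Sum>i<k. f (?m + i))" for f :: "nat \<Rightarrow> 'a" and k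
    by (induction k) (simp_all add: add.assoc del: sum.lessThan_Suc add: sum.lessThan_Suc[of _ "?m + _"]
      sum.lessThan_Suc)
  have conj_coeff: "psi_coeff ^ 2 ^ (?m + i) = (conj psi_coeff) ^ 2 ^ i" for i
    by (unfold conj_def) (simp only: q_eq power_add[of 2 ?m i] power_mult)
  have "4 * e + 2 = ?m + ?m" by simp
  then have "partial_trace (4 * e + 2) = (\<Sum>i<?m + ?m. psi_coeff ^ 2 ^ i)"
    by (simp only: partial_trace_def)
  also have "\<dots> = (\<Sum>i<?m. psi_coeff ^ 2 ^ i + (conj psi_coeff) ^ 2 ^ i)"
    unfolding split conj_coeff sum.distrib ..
  also have "\<dots> = (\<Sum>i<?m. (im psi_coeff) ^ 2 ^ i)"
    by (simp only: im_def frobenius_add[OF char_two] add.commute)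
  also have "im psi_coeff = delta_root"
    unfolding psi_coeff_coords by (rule im_coords[OF delta_root_Fq delta_root_Fq])
  also have "(\<Sum>i<?m. delta_root ^ 2 ^ i) = (\<Sum>i<?m. (\<delta> ^ 2 ^ i) ^ 2 ^ e)"
    by (simp add: delta_root_def mult.commute flip: power_mult)
  also have "\<dots> = absolute_trace ?m \<delta> ^ 2 ^ e"
    unfolding absolute_trace_def by (rule field_automorphism_sum[OF frobenius_automorphism, symmetric])
  finally show ?thesis by (simp only: trace_delta power_one)
qed

sublocale PGammaL: group "PGammaL :: (('a ^ 3) set \<Rightarrow> _) monoid"
  by (rule group_PGammaL)

text \<open>In the coordinate \<open>y = psi_coeff * x\<close> the action of \<open>\<psi>\<close> is \<open>y \<mapsto> y\<^sup>2 + psi_coeff\<close>.\<close>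

lemma psi_pow_aff:
  "\<exists>z. (\<psi> [^]\<^bsub>PGammaL\<^esub> k) (aff 0 0) = aff (partial_trace k / psi_coeff) z"
proof (induction k)
  case 0
  then show ?case by (auto simp: partial_trace_def PGammaL_simps aff_in_points)
next
  case (Suc k)
  then obtain z where z: "(\<psi> [^]\<^bsub>PGammaL\<^esub> k) (aff 0 0) = aff (partial_trace k / psi_coeff) z" by blast
  have "(\<psi> [^]\<^bsub>PGammaL\<^esub> Suc k) (aff 0 0) = (\<psi> \<otimes>\<^bsub>PGammaL\<^esub> \<psi> [^]\<^bsub>PGammaL\<^esub> k) (aff 0 0)"
    by (simp only: PGammaL.nat_pow_Suc2[OF psi_in_PGammaL])
  also have "\<dots> = \<psi> (aff (partial_trace k / psi_coeff) z)"
    using psi_in_PGammaL by (simp add: PGammaL_apply_mult aff_in_points z)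
  also note psi_aff
  also have "1 + (partial_trace k / psi_coeff)\<^sup>2 * psi_coeff = partial_trace (Suc k) / psi_coeff"
    using psi_coeff_nonzero by (simp add: partial_trace_Suc field_simps power2_eq_square)
  finally show ?case by blast
qed

text \<open>Only the companion automorphism of a power is needed later, so the matrix remains
  existential.\<close>

lemma psi_pow_collineation:
  "\<exists>B. invertible B \<and> \<psi> [^]\<^bsub>PGammaL\<^esub> k = collineation (\<lambda>x. x ^ 2 ^ k) B"
proof (induction k)
  case 0
  have "(\<lambda>x. x ^ 2 ^ 0) = (id :: 'a \<Rightarrow> 'a)" by auto
  moreover have "invertible (mat 1 :: 'a ^ 3 ^ 3)" by (auto simp: invertible_def)
  ultimately show ?case using collineation_id by (metis PGammaL.nat_pow_0 PGammaL_simps(2))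
next
  case (Suc k)
  then obtain B where B: "invertible B" "\<psi> [^]\<^bsub>PGammaL\<^esub> k = collineation (\<lambda>x. x ^ 2 ^ k) B" by blast
  have "((\<lambda>x. x ^ 2 ^ k) \<circ> (\<lambda>x. x ^ 2 ^ 1)) = (\<lambda>x :: 'a. x ^ 2 ^ Suc k)"
    by (auto simp: power_mult)
  then have "\<psi> [^]\<^bsub>PGammaL\<^esub> Suc k =
      collineation (\<lambda>x. x ^ 2 ^ Suc k) (map_matrix (\<lambda>x. x ^ 2 ^ k) psi_matrix ** B)"
    using collineation_mult[OF frobenius_automorphism B(1) frobenius_automorphism invertible_psi_matrix,
        of k 1] B(2) by (simp only: PGammaL.nat_pow_Suc psi_eq)
  then show ?case
    using B(1) invertible_psi_matrix
    by (blast intro: invertible_mult map_matrix_invertible[OF frobenius_automorphism])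
qed

section \<open>Exponents of the Frobenius map\<close>

lemma card_UNIV_power: "CARD('a) = 2 ^ (4 * e + 2)"
  by (simp add: card_UNIV_eq q_eq flip: power_mult)

text \<open>The difference of two monomials of degree below \<open>CARD('a)\<close> vanishes on the
  whole field only if it is the zero polynomial.\<close>

lemma frobenius_power_eq_iff:
  assumes "i < 4 * e + 2" "j < 4 * e + 2"
  shows "(\<lambda>x :: 'a. x ^ 2 ^ i) = (\<lambda>x. x ^ 2 ^ j) \<longleftrightarrow> i = j"
proof
  assume eq: "(\<lambda>x :: 'a. x ^ 2 ^ i) = (\<lambda>x. x ^ 2 ^ j)"
  define p :: "'a poly" where "p = Polynomial.monom 1 (2 ^ i) - Polynomial.monom 1 (2 ^ j)"
  have "poly p x = 0" for x
    using fun_cong[OF eq, of x] by (simp add: p_def poly_monom)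
  then have "card {x. poly p x = 0} = 2 ^ (4 * e + 2)"
    by (simp add: card_UNIV_power)
  moreover have "Polynomial.degree p < 2 ^ (4 * e + 2)"
  proof -
    have "2 ^ i < (2 :: nat) ^ (4 * e + 2)" "2 ^ j < (2 :: nat) ^ (4 * e + 2)"
      using assms by (intro power_strict_increasing; simp)+
    then show ?thesis
      unfolding p_def
      by (intro le_less_trans[OF degree_diff_le_max])
        (simp only: degree_monom_eq one_neq_zero not_False_eq_True max_less_iff_conj)
  qed
  ultimately have "p = 0"
    using card_poly_roots_bound[of p] by (cases "p = 0") auto
  then have "Polynomial.coeff p (2 ^ i) = 0" by simp
  then show "i = j" by (auto simp: p_def split: if_splits)
qed auto

lemma frobenius_power_mod:
  "(\<lambda>x :: 'a. x ^ 2 ^ k) = (\<lambda>x. x ^ 2 ^ (k mod (4 * e + 2)))"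
proof
  fix x :: 'a
  let ?n = "4 * e + 2"
  have "x ^ 2 ^ k = x ^ 2 ^ (?n * (k div ?n) + k mod ?n)" by (simp only: mult_div_mod_eq)
  also have "\<dots> = (x ^ (2 ^ ?n) ^ (k div ?n)) ^ 2 ^ (k mod ?n)"
    by (simp only: power_add power_mult)
  also have "x ^ (2 ^ ?n) ^ (k div ?n) = x"
    by (rule finite_field_power_card_power_eq_same) (simp only: card_UNIV_power)
  finally show "x ^ 2 ^ k = x ^ 2 ^ (k mod ?n)" .
qed

section \<open>The order of \<psi> and the full stabiliser\<close>

abbreviation "stabiliser \<equiv> set_stabiliser PGammaL unital_set"

abbreviation "linear_stabiliser \<equiv> set_stabiliser PGL unital_set"

lemma subgroup_stabiliser: "subgroup stabiliser PGammaL"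
  by (rule subgroup_set_stabiliser[OF unital_subset_points])

lemma psi_in_stabiliser: "\<psi> \<in> stabiliser"
  by (simp add: set_stabiliser_def psi_in_PGammaL psi_stabilises)

lemma psi_pow_in_stabiliser: "\<psi> [^]\<^bsub>PGammaL\<^esub> (k :: nat) \<in> stabiliser"
proof (induction k)
  case 0
  then show ?case using subgroup.one_closed[OF subgroup_stabiliser] by simp
next
  case (Suc k)
  then show ?case using subgroup.m_closed[OF subgroup_stabiliser] psi_in_stabiliser by simp
qed

lemma psi_pow_full:
  obtains u v where "u \<noteq> 0" "\<psi> [^]\<^bsub>PGammaL\<^esub> (4 * e + 2) = trans u v"
proof -
  let ?p = "\<psi> [^]\<^bsub>PGammaL\<^esub> (4 * e + 2)"
  obtain B where B: "invertible B" "?p = collineation (\<lambda>x. x ^ 2 ^ (4 * e + 2)) B"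
    using psi_pow_collineation by blast
  have "x ^ 2 ^ (4 * e + 2) = x" for x :: 'a
    using finite_field_power_card_eq_same[of x] by (simp only: card_UNIV_power)
  then have "(\<lambda>x :: 'a. x ^ 2 ^ (4 * e + 2)) = id" by (intro ext) (simp only: id_apply)
  with B have "?p \<in> carrier PGL" by (auto simp: carrier_PGL)
  then have "?p \<in> linear_stabiliser"
    using psi_pow_in_stabiliser[of "4 * e + 2"] unfolding set_stabiliser_PGL by blast
  then obtain u v where uv: "?p = trans u v"
    by (auto simp: stabiliser_PGL)
  obtain z where "trans u v (aff 0 0) = aff (1 / psi_coeff) z"
    using psi_pow_aff[of "4 * e + 2"] unfolding partial_trace_full uv by blast
  then have "u * \<epsilon> = 1 / psi_coeff" by (simp add: trans_aff aff_eq_iff)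
  then have "u \<noteq> 0" using psi_coeff_nonzero by auto
  with uv show thesis using that by blast
qed

text \<open>Companion automorphisms show that \<open>4 * e + 2\<close> divides the order. The power
  with that exponent is some \<open>trans u v\<close> with \<open>u \<noteq> 0\<close>, whose fourth
  power is trivial and whose square is \<open>trans 0 (u * u * \<delta>)\<close>, not the
  identity.\<close>

lemma ord_psi: "PGammaL.ord \<psi> = 16 * e + 8"
proof -
  let ?n = "4 * e + 2" and ?o = "PGammaL.ord \<psi>"
  obtain u v where u: "u \<noteq> 0" and uv: "\<psi> [^]\<^bsub>PGammaL\<^esub> ?n = trans u v" by (rule psi_pow_full)
  have pow: "trans u v [^]\<^bsub>PGammaL\<^esub> j = \<psi> [^]\<^bsub>PGammaL\<^esub> (?n * j)" for j
    unfolding uv[symmetric] by (rule PGammaL.nat_pow_pow[OF psi_in_PGammaL])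
  have t2: "trans u v [^]\<^bsub>PGammaL\<^esub> (2 :: nat) = trans 0 (u * u * \<delta>)"
    using trans_in_PGammaL by (simp add: numeral_2_eq_2 trans_mult)
  have "trans u v [^]\<^bsub>PGammaL\<^esub> (4 :: nat) =
      (trans u v [^]\<^bsub>PGammaL\<^esub> (2 :: nat)) [^]\<^bsub>PGammaL\<^esub> (2 :: nat)"
    by (simp add: PGammaL.nat_pow_pow trans_in_PGammaL)
  also have "\<dots> = \<one>\<^bsub>PGammaL\<^esub>"
    unfolding t2 using trans_in_PGammaL by (simp add: numeral_2_eq_2 trans_mult trans_0)
  finally have "\<psi> [^]\<^bsub>PGammaL\<^esub> (?n * 4) = \<one>\<^bsub>PGammaL\<^esub>" by (simp only: pow)
  then have dvd: "?o dvd ?n * 4" using psi_in_PGammaL by (simp only: PGammaL.pow_eq_id)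
  have "?n dvd ?o"
  proof -
    obtain B where B: "invertible B" "\<psi> [^]\<^bsub>PGammaL\<^esub> ?o = collineation (\<lambda>x. x ^ 2 ^ ?o) B"
      using psi_pow_collineation by blast
    have "collineation (\<lambda>x. x ^ 2 ^ ?o) B = collineation id (mat 1 :: 'a ^ 3 ^ 3)"
      using B(2) psi_in_PGammaL by (simp add: collineation_id PGammaL_simps(2))
    moreover have "invertible (mat 1 :: 'a ^ 3 ^ 3)" by (auto simp: invertible_def)
    ultimately have "(\<lambda>x :: 'a. x ^ 2 ^ ?o) = id"
      using collineation_automorphism_unique[OF frobenius_automorphism B(1) field_automorphism_id]
      by blast
    also have "id = (\<lambda>x :: 'a. x ^ 2 ^ 0)" by auto
    finally have "?o mod ?n = 0"
      unfolding frobenius_power_mod[of ?o] by (subst (asm) frobenius_power_eq_iff) auto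
    then show ?thesis by (simp only: mod_eq_0_iff_dvd)
  qed
  then obtain j where j: "?o = ?n * j" by blast
  have "?n * j dvd ?n * 4" using dvd unfolding j .
  moreover have "0 < ?n" by simp
  ultimately have j4: "j dvd 4" by (rule nat_mult_dvd_cancel1[THEN iffD1, rotated])
  then have "j \<le> 4" by (rule dvd_imp_le) simp
  moreover have "j \<noteq> 0" "j \<noteq> 3" using j4 by (metis dvd_0_left zero_neq_numeral, auto)
  ultimately have "j = 1 \<or> j = 2 \<or> j = 4" by linarith
  moreover have one: "trans u v [^]\<^bsub>PGammaL\<^esub> j = \<one>\<^bsub>PGammaL\<^esub>"
    unfolding pow j[symmetric] using psi_in_PGammaL by (rule PGammaL.pow_ord_eq_1)
  moreover have "j \<noteq> 1"
    using one u trans_in_PGammaL by (auto simp: trans_eq_iff simp flip: trans_0)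
  moreover have "j \<noteq> 2"
    using one u delta_nonzero by (auto simp: t2 trans_eq_iff simp flip: trans_0)
  ultimately show ?thesis using j by auto
qed

text \<open>The companion automorphism is the \<open>i\<close>-th Frobenius power, as is that of the
  \<open>i\<close>-th power of \<psi>; dividing by the latter leaves a projectivity.\<close>

lemma stabiliser_decomposition:
  assumes h: "h \<in> stabiliser"
  obtains g i where "g \<in> linear_stabiliser" "i < 4 * e + 2"
    "h = g \<otimes>\<^bsub>PGammaL\<^esub> \<psi> [^]\<^bsub>PGammaL\<^esub> i"
proof -
  obtain \<tau> A where A: "h = collineation \<tau> A" "field_automorphism \<tau>" "invertible A"
    using h by (auto simp: set_stabiliser_def PGammaL_simps)
  \<comment> \<open>The size condition of \<open>automorphism_eq_frobenius_power\<close>, with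
    \<open>m = 2 * e + 1\<close>.\<close>
  have "2 * (2 * e + 1) < q"
  proof -
    have "4 * k + 2 < (2 :: nat) ^ (2 * k + 1)" if "k \<ge> 1" for k
      using that by (induction k rule: dec_induct) auto
    then show ?thesis using e_ge_1 q_eq by simp
  qed
  then obtain i where i: "i < 4 * e + 2" "\<tau> = (\<lambda>x. x ^ 2 ^ i)"
    using automorphism_eq_frobenius_power[OF char_two _ _ A(2), of "2 * e + 1"] card_UNIV_eq q_eq
    by auto
  let ?p = "\<psi> [^]\<^bsub>PGammaL\<^esub> i"
  define g where "g = h \<otimes>\<^bsub>PGammaL\<^esub> inv\<^bsub>PGammaL\<^esub> ?p"
  have pG: "?p \<in> carrier PGammaL" and hG: "h \<in> carrier PGammaL"
    using psi_in_PGammaL h by (auto simp: set_stabiliser_def)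
  have gS: "g \<in> stabiliser"
    unfolding g_def using h psi_pow_in_stabiliser subgroup_stabiliser
    by (meson subgroup.m_closed subgroup.m_inv_closed)
  have h_eq: "h = g \<otimes>\<^bsub>PGammaL\<^esub> ?p" using pG hG by (simp add: g_def PGammaL.m_assoc)
  obtain \<rho> C where C: "g = collineation \<rho> C" "field_automorphism \<rho>" "invertible C"
    using gS by (auto simp: set_stabiliser_def PGammaL_simps)
  obtain B where B: "invertible B" "?p = collineation (\<lambda>x. x ^ 2 ^ i) B"
    using psi_pow_collineation by blast
  have "collineation \<tau> A = g \<otimes>\<^bsub>PGammaL\<^esub> ?p" using h_eq A(1) by simp
  also have "\<dots> = collineation (\<rho> \<circ> (\<lambda>x. x ^ 2 ^ i)) (map_matrix \<rho> B ** C)"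
    unfolding C(1) B(2) by (rule collineation_mult[OF C(2,3) frobenius_automorphism B(1)])
  finally have "\<tau> = \<rho> \<circ> (\<lambda>x. x ^ 2 ^ i)"
    by (rule collineation_automorphism_unique[rotated 4])
      (auto intro!: field_automorphism_comp C frobenius_automorphism invertible_mult
        map_matrix_invertible A B)
  then have "\<rho> (x ^ 2 ^ i) = x ^ 2 ^ i" for x
    unfolding i(2) by (metis comp_apply)
  moreover have "surj (\<lambda>x :: 'a. x ^ 2 ^ i)"
    by (rule bij_is_surj[OF field_automorphismD(1)[OF frobenius_automorphism]])
  ultimately have "\<rho> y = id y" for y
    using surjD[of "\<lambda>x :: 'a. x ^ 2 ^ i" y] by auto
  then have "\<rho> = id" by (rule ext)
  then have "g \<in> linear_stabiliser"
    using C gS by (auto simp: set_stabiliser_PGL carrier_PGL)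
  with i h_eq show thesis using that by blast
qed

text \<open>The linear stabiliser and the group generated by \<psi> intersect nontrivially, so
  exponents below \<open>4 * e + 2\<close> are counted instead; the companion automorphism of a
  product recovers the exponent.\<close>

lemma card_stabiliser: "card stabiliser = q ^ 2 * (4 * e + 2)"
proof -
  let ?f = "\<lambda>(g, i). g \<otimes>\<^bsub>PGammaL\<^esub> \<psi> [^]\<^bsub>PGammaL\<^esub> (i :: nat)"
  let ?D = "linear_stabiliser \<times> {..<4 * e + 2}"
  have GS: "linear_stabiliser \<subseteq> stabiliser" by (simp add: set_stabiliser_PGL)
  have GG: "linear_stabiliser \<subseteq> carrier PGammaL" using GS by (auto simp: set_stabiliser_def)
  have "inj_on ?f ?D"
  proof (rule inj_onI, clarify)
    fix g i g' j
    assume g: "g \<in> linear_stabiliser" "g' \<in> linear_stabiliser" and ij: "i < 4 * e + 2" "j < 4 * e + 2"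
      and eq: "g \<otimes>\<^bsub>PGammaL\<^esub> \<psi> [^]\<^bsub>PGammaL\<^esub> i = g' \<otimes>\<^bsub>PGammaL\<^esub> \<psi> [^]\<^bsub>PGammaL\<^esub> j"
    obtain A where A: "g = collineation id A" "invertible A" using g(1) by (auto simp: set_stabiliser_def carrier_PGL)
    obtain A' where A': "g' = collineation id A'" "invertible A'" using g(2) by (auto simp: set_stabiliser_def carrier_PGL)
    obtain B where B: "invertible B" "\<psi> [^]\<^bsub>PGammaL\<^esub> i = collineation (\<lambda>x. x ^ 2 ^ i) B"
      using psi_pow_collineation by blast
    obtain B' where B': "invertible B'" "\<psi> [^]\<^bsub>PGammaL\<^esub> j = collineation (\<lambda>x. x ^ 2 ^ j) B'"
      using psi_pow_collineation by blast
    have "collineation (\<lambda>x. x ^ 2 ^ i) (map_matrix id B ** A) =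
        collineation (\<lambda>x. x ^ 2 ^ j) (map_matrix id B' ** A')"
      using eq collineation_mult[OF field_automorphism_id A(2) frobenius_automorphism B(1), of i]
        collineation_mult[OF field_automorphism_id A'(2) frobenius_automorphism B'(1), of j]
      by (simp add: A(1) A'(1) B(2) B'(2))
    then have "(\<lambda>x :: 'a. x ^ 2 ^ i) = (\<lambda>x. x ^ 2 ^ j)"
      by (rule collineation_automorphism_unique[rotated 4])
        (auto intro!: frobenius_automorphism invertible_mult map_matrix_invertible
          field_automorphism_id A A' B B')
    then have "i = j" using frobenius_power_eq_iff[OF ij] by simp
    moreover have "g = g'"
      using eq g GG psi_in_PGammaL unfolding \<open>i = j\<close> by (simp add: subset_iff)
    ultimately show "g = g' \<and> i = j" by simp
  qed
  moreover have "?f ` ?D = stabiliser"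
  proof
    show "?f ` ?D \<subseteq> stabiliser"
      using GS subgroup.m_closed[OF subgroup_stabiliser] psi_pow_in_stabiliser by auto
    show "stabiliser \<subseteq> ?f ` ?D"
    proof
      fix h assume "h \<in> stabiliser"
      then obtain g i where "g \<in> linear_stabiliser" "i < 4 * e + 2"
        "h = g \<otimes>\<^bsub>PGammaL\<^esub> \<psi> [^]\<^bsub>PGammaL\<^esub> i"
        by (rule stabiliser_decomposition)
      then show "h \<in> ?f ` ?D" by (intro image_eqI[of _ _ "(g, i)"]) auto
    qed
  qed
  ultimately have "bij_betw ?f ?D stabiliser" unfolding bij_betw_def by (rule conjI)
  then have "card stabiliser = card ?D" by (rule bij_betw_same_card[symmetric])
  then show ?thesis by (simp add: card_cartesian_product card_stabiliser_PGL)
qed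

section \<open>The cyclic group generated by \<psi>\<close>

abbreviation "psi_group \<equiv> generate PGammaL {\<psi>}"

lemma subgroup_psi_group: "subgroup psi_group PGammaL"
  by (rule PGammaL.generate_is_subgroup) (simp add: psi_in_PGammaL)

lemma psi_in_psi_group: "\<psi> \<in> psi_group"
  by (rule generate.incl) simp

lemma stabiliser_eq_set_mult: "stabiliser = linear_stabiliser <#>\<^bsub>PGammaL\<^esub> psi_group"
proof
  show "stabiliser \<subseteq> linear_stabiliser <#>\<^bsub>PGammaL\<^esub> psi_group"
  proof
    fix h assume "h \<in> stabiliser"
    then obtain g i where "g \<in> linear_stabiliser" "i < 4 * e + 2" "h = g \<otimes>\<^bsub>PGammaL\<^esub> \<psi> [^]\<^bsub>PGammaL\<^esub> i"
      by (rule stabiliser_decomposition)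
    moreover have "\<psi> [^]\<^bsub>PGammaL\<^esub> i \<in> psi_group"
      using subgroup_psi_group psi_in_psi_group
      by (induction i) (auto simp: subgroup.one_closed subgroup.m_closed)
    ultimately show "h \<in> linear_stabiliser <#>\<^bsub>PGammaL\<^esub> psi_group"
      by (auto simp: set_mult_def)
  qed
  have "psi_group \<subseteq> stabiliser"
    using PGammaL.generate_subgroup_incl[OF _ subgroup_stabiliser] psi_in_stabiliser by simp
  then show "linear_stabiliser <#>\<^bsub>PGammaL\<^esub> psi_group \<subseteq> stabiliser"
    using subgroup.m_closed[OF subgroup_stabiliser] by (auto simp: set_mult_def set_stabiliser_PGL)
qed

lemma card_psi_group: "card psi_group = 16 * e + 8"
  using PGammaL.generate_pow_card[OF psi_in_PGammaL] ord_psi by simp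

text \<open>Generation inside the subgroup agrees with generation in \<open>PGammaL\<close>, so
  \<psi> remains a generator.\<close>

lemma cyclic_psi_group: "cyclic_group (PGammaL\<lparr>carrier := psi_group\<rparr>)"
  unfolding cyclic_group_def subgroup_generated_def
  using psi_in_psi_group PGammaL.generate_consistent[OF _ subgroup_psi_group, of "{\<psi>}"]
  by (intro bexI[of _ \<psi>]) simp_all

end

theorem theorem2:
  fixes e q :: nat and \<epsilon> \<delta> :: "'a::finite_field" and U :: "('a ^ 3) set set"
    and G K :: "(('a ^ 3) set \<Rightarrow> ('a ^ 3) set) set"
  assumes "e \<ge> 1" and "q = 2 ^ (2 * e + 1)" and "CARD('a) = q ^ 2"
    and "\<epsilon> ^ q = \<epsilon> + 1" and "\<epsilon> ^ 2 = \<epsilon> + \<delta>"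
    and "\<delta> \<in> Fq q" and "\<delta> \<noteq> 1" and "absolute_trace (2 * e + 1) \<delta> = 1"
    and "buekenhout_tits_unital e U" and "U = U_BT e \<epsilon>"
    and "G = set_stabiliser PGL U"
    and "K = generate PGammaL {psi e \<epsilon> \<delta>}"
  shows "set_stabiliser PGammaL U = G <#>\<^bsub>PGammaL\<^esub> K
    \<and> card (set_stabiliser PGammaL U) = q ^ 2 * (4 * e + 2)
    \<and> subgroup K PGammaL
    \<and> cyclic_group (PGammaL\<lparr>carrier := K\<rparr>)
    \<and> card K = 16 * e + 8"
proof -
  interpret tits_setting e q \<epsilon> \<delta>
    by unfold_locales (fact assms)+
  show ?thesis
    unfolding assms(10-12)
    using stabiliser_eq_set_mult card_stabiliser subgroup_psi_group cyclic_psi_group card_psi_group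
    by blast
qed

end
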